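(* Polytree Learning with maximum parent set size $k$ (PT$_{\le}$) admits a polynomial-time $(k+1)$-approximation algorithm: an algorithm running in time polynomial in the input length that outputs a polytree $D$ with $f(D)\le f(D^{\mathrm{opt}})\le (k+1)\,f(D)$, where $D^{\mathrm{opt}}$ is a maximum-score polytree.
   Context: A DAG $D=(V,A)$ is a polytree if its skeleton is a forest; $D_v$ is the parent set of $v$. Input: node set $V$ and for each $v\in V$ a family $\mathcal{F}_v$ of potential parent sets, each of size at most $k$, with real scores $f_v(S)$ for $S\in\mathcal{F}_v$; $f_v(S)=-\infty$ for $S\notin\mathcal{F}_v$; $\emptyset\in\mathcal{F}_v$ and $f_v(\emptyset)=0$. The score of $D$ is $f(D)=\sum_v f_v(D_v)$. The goal (PT$_{\le}$) is a polytree of maximum score. *)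

theory Defs
  imports "HOL-Library.Extended_Real" "HOL-Computational_Algebra.Polynomial"
begin

section \<open>Polytrees\<close>

definition skeleton :: "('a \<times> 'a) set \<Rightarrow> 'a set set" where
  "skeleton A = {{u, v} | u v. (u, v) \<in> A}"

definition ugraph_cycle :: "'a set set \<Rightarrow> 'a list \<Rightarrow> bool" where
  "ugraph_cycle E c \<longleftrightarrow> 3 \<le> length c \<and> distinct c \<and>
     (\<forall>i < length c. {c ! i, c ! (Suc i mod length c)} \<in> E)"

definition forest :: "'a set set \<Rightarrow> bool" where
  "forest E \<longleftrightarrow> (\<nexists>c. ugraph_cycle E c)"

definition dag :: "'a set \<Rightarrow> ('a \<times> 'a) set \<Rightarrow> bool" where
  "dag V A \<longleftrightarrow> A \<subseteq> V \<times> V \<and> acyclic A"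

definition polytree :: "'a set \<Rightarrow> ('a \<times> 'a) set \<Rightarrow> bool" where
  "polytree V A \<longleftrightarrow> dag V A \<and> forest (skeleton A)"

definition parents :: "('a \<times> 'a) set \<Rightarrow> 'a \<Rightarrow> 'a set" where
  "parents A v = {u. (u, v) \<in> A}"


section \<open>Polytree Learning\<close>

text \<open>Nodes are named by natural numbers so that instances can be written down as finite data;
  the node set is an arbitrary finite set of such names.\<close>

record pt_instance =
  nodes :: "nat set"
  families :: "nat \<Rightarrow> nat set set"
  local_score :: "nat \<Rightarrow> nat set \<Rightarrow> ereal"

definition valid_instance :: "nat \<Rightarrow> pt_instance \<Rightarrow> bool" where
  "valid_instance k I \<longleftrightarrow> finite (nodes I) \<and>
     (\<forall>v \<in> nodes I.
        families I v \<subseteq> Pow (nodes I - {v}) \<and>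
        (\<forall>S \<in> families I v. card S \<le> k \<and> \<bar>local_score I v S\<bar> \<noteq> \<infinity>) \<and>
        (\<forall>S. S \<notin> families I v \<longrightarrow> local_score I v S = - \<infinity>) \<and>
        {} \<in> families I v \<and> local_score I v {} = 0)"

definition score :: "pt_instance \<Rightarrow> (nat \<times> nat) set \<Rightarrow> ereal" where
  "score I A = (\<Sum>v \<in> nodes I. local_score I v (parents A v))"

definition max_score_polytree :: "pt_instance \<Rightarrow> (nat \<times> nat) set \<Rightarrow> bool" where
  "max_score_polytree I A \<longleftrightarrow> polytree (nodes I) A \<and>
     (\<forall>B. polytree (nodes I) B \<longrightarrow> score I B \<le> score I A)"

lemma max_score_polytree_exists:
  assumes "valid_instance k I"
  shows "\<exists>A. max_score_polytree I A"
proof -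
  let ?P = "{A. polytree (nodes I) A}"
  have "?P \<subseteq> Pow (nodes I \<times> nodes I)"
    by (auto simp: polytree_def dag_def)
  then have fin: "finite ?P"
    using assms by (auto simp: valid_instance_def intro: finite_subset)
  have "skeleton ({} :: (nat \<times> nat) set) = {}"
    by (simp add: skeleton_def)
  moreover have "\<not> ugraph_cycle {} c" for c :: "nat list"
  proof
    assume "ugraph_cycle {} c"
    then have "3 \<le> length c" "\<forall>i < length c. False"
      by (simp_all add: ugraph_cycle_def)
    then show False
      by (metis gr0I not_numeral_le_zero)
  qed
  ultimately have "{} \<in> ?P"
    by (simp add: polytree_def dag_def forest_def acyclic_def)
  with fin obtain A where A: "A \<in> ?P" "score I A = Max (score I ` ?P)"
    by (metis (no_types, lifting) Max_in empty_iff finite_imageI imageE image_is_empty)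
  then have "score I B \<le> score I A" if "B \<in> ?P" for B
    using fin that by simp
  with A(1) show ?thesis
    by (auto simp: max_score_polytree_def)
qed


section \<open>Programs and their running time\<close>

text \<open>Algorithms are programs of a WHILE language over binary trees. Real scores are opaque leaves:
  a program may compare them with each other and with zero, but there is no arithmetic on them,
  so no computational power is hidden in the unit size of a real number. If all scores are
  rational, replacing every comparison by one of binary numerals turns such a program into an
  ordinary algorithm with a polynomial overhead in the bit length.

  Evaluating an expression costs the total size of the values of all its subexpressions.
  Building or copying a tree is thus charged by its full size, sharing of subtrees gives no
  advantage, and the running time bounds the size of the output.\<close>

datatype val = VNil | VReal real | VPair val val

fun val_size :: "val \<Rightarrow> nat" where
  "val_size VNil = 1"
| "val_size (VReal r) = 1"
| "val_size (VPair a b) = 1 + val_size a + val_size b"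

datatype expr =
    Var nat
  | NilE
  | ZeroE
  | ConsE expr expr
  | HdE expr
  | TlE expr
  | EqE expr expr
  | LessE expr expr

type_synonym state = "nat \<Rightarrow> val"

fun val_hd :: "val \<Rightarrow> val" where
  "val_hd (VPair a b) = a"
| "val_hd a = VNil"

fun val_tl :: "val \<Rightarrow> val" where
  "val_tl (VPair a b) = b"
| "val_tl a = VNil"

fun val_less :: "val \<Rightarrow> val \<Rightarrow> bool" where
  "val_less (VReal r) (VReal s) = (r < s)"
| "val_less a b = False"

definition val_bool :: "bool \<Rightarrow> val" where
  "val_bool b = (if b then VPair VNil VNil else VNil)"

fun eval :: "expr \<Rightarrow> state \<Rightarrow> val" where
  "eval (Var x) s = s x"
| "eval NilE s = VNil"
| "eval ZeroE s = VReal 0"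
| "eval (ConsE e f) s = VPair (eval e s) (eval f s)"
| "eval (HdE e) s = val_hd (eval e s)"
| "eval (TlE e) s = val_tl (eval e s)"
| "eval (EqE e f) s = val_bool (eval e s = eval f s)"
| "eval (LessE e f) s = val_bool (val_less (eval e s) (eval f s))"

fun eval_time :: "expr \<Rightarrow> state \<Rightarrow> nat" where
  "eval_time (ConsE e f) s = val_size (eval (ConsE e f) s) + eval_time e s + eval_time f s"
| "eval_time (HdE e) s = val_size (eval (HdE e) s) + eval_time e s"
| "eval_time (TlE e) s = val_size (eval (TlE e) s) + eval_time e s"
| "eval_time (EqE e f) s = val_size (eval (EqE e f) s) + eval_time e s + eval_time f s"
| "eval_time (LessE e f) s = val_size (eval (LessE e f) s) + eval_time e s + eval_time f s"
| "eval_time e s = val_size (eval e s)"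

datatype com =
    Skip
  | Assign nat expr
  | Seq com com
  | Cond expr com com
  | While expr com

text \<open>\<open>exec c s t s'\<close>: started in state \<open>s\<close>, command \<open>c\<close> halts in state \<open>s'\<close> after time \<open>t\<close>.
  As a condition, \<open>VNil\<close> counts as false and every other value as true.\<close>

inductive exec :: "com \<Rightarrow> state \<Rightarrow> nat \<Rightarrow> state \<Rightarrow> bool" where
  Skip: "exec Skip s 1 s"
| Assign: "exec (Assign x e) s (1 + eval_time e s) (s(x := eval e s))"
| Seq: "exec c s t s' \<Longrightarrow> exec d s' t' s'' \<Longrightarrow> exec (Seq c d) s (1 + t + t') s''"
| CondTrue: "eval e s \<noteq> VNil \<Longrightarrow> exec c s t s' \<Longrightarrow>
    exec (Cond e c d) s (1 + eval_time e s + t) s'"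
| CondFalse: "eval e s = VNil \<Longrightarrow> exec d s t s' \<Longrightarrow>
    exec (Cond e c d) s (1 + eval_time e s + t) s'"
| WhileFalse: "eval e s = VNil \<Longrightarrow> exec (While e c) s (1 + eval_time e s) s"
| WhileTrue: "eval e s \<noteq> VNil \<Longrightarrow> exec c s t s' \<Longrightarrow> exec (While e c) s' t' s'' \<Longrightarrow>
    exec (While e c) s (1 + eval_time e s + t + t') s''"

inductive_cases exec_SkipE: "exec Skip s t s'"
inductive_cases exec_AssignE: "exec (Assign x e) s t s'"
inductive_cases exec_SeqE: "exec (Seq c d) s t s'"
inductive_cases exec_CondE: "exec (Cond e c d) s t s'"
inductive_cases exec_WhileE: "exec (While e c) s t s'"

lemma exec_deterministic:
  "exec c s t s' \<Longrightarrow> exec c s u s'' \<Longrightarrow> u = t \<and> s'' = s'"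
proof (induction arbitrary: u s'' rule: exec.induct)
  case Skip then show ?case by (auto elim: exec_SkipE)
next
  case Assign then show ?case by (auto elim: exec_AssignE)
next
  case Seq
  from Seq.prems show ?case by (auto elim!: exec_SeqE dest!: Seq.IH)
next
  case CondTrue
  from CondTrue.prems CondTrue.hyps show ?case by (auto elim!: exec_CondE dest!: CondTrue.IH)
next
  case CondFalse
  from CondFalse.prems CondFalse.hyps show ?case by (auto elim!: exec_CondE dest!: CondFalse.IH)
next
  case WhileFalse
  from WhileFalse.prems WhileFalse.hyps show ?case by (auto elim: exec_WhileE)
next
  case (WhileTrue e s c t s' t' s2)
  from WhileTrue.prems show ?case
  proof (cases rule: exec.cases)
    case WhileFalse then show ?thesis using WhileTrue.hyps by simp
  next
    case (WhileTrue v r v')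
    then show ?thesis using WhileTrue.IH by fastforce
  qed
qed

text \<open>Input and output are passed in variable \<open>0\<close>; all other variables are initially \<open>VNil\<close>.\<close>

definition computes :: "com \<Rightarrow> val \<Rightarrow> nat \<Rightarrow> val \<Rightarrow> bool" where
  "computes P x t y \<longleftrightarrow> (\<exists>s. exec P ((\<lambda>_. VNil)(0 := x)) t s \<and> s 0 = y)"


section \<open>Encodings\<close>

text \<open>Binary, least significant bit first.\<close>

fun enc_nat :: "nat \<Rightarrow> val" where
  "enc_nat n = (if n = 0 then VNil else VPair (val_bool (odd n)) (enc_nat (n div 2)))"

declare enc_nat.simps [simp del]

definition enc_list :: "('a \<Rightarrow> val) \<Rightarrow> 'a list \<Rightarrow> val" where
  "enc_list enc xs = foldr (\<lambda>x. VPair (enc x)) xs VNil"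

definition enc_pair :: "('a \<Rightarrow> val) \<Rightarrow> ('b \<Rightarrow> val) \<Rightarrow> 'a \<times> 'b \<Rightarrow> val" where
  "enc_pair enc enc' p = VPair (enc (fst p)) (enc' (snd p))"

text \<open>An instance is written down as a list that gives, for every node, the list of its potential
  parent sets together with their scores. The order of nodes, of families and of the elements of
  a parent set is arbitrary.\<close>

type_synonym listing = "(nat \<times> (nat list \<times> real) list) list"

definition lists_family :: "(nat list \<times> real) list \<Rightarrow> nat set set \<Rightarrow> (nat set \<Rightarrow> ereal) \<Rightarrow> bool" where
  "lists_family ps F f \<longleftrightarrow>
     distinct (map (set \<circ> fst) ps) \<and> set ` fst ` set ps = F \<and>
     (\<forall>(S, r) \<in> set ps. distinct S \<and> f (set S) = ereal r)"

definition lists_instance :: "listing \<Rightarrow> pt_instance \<Rightarrow> bool" where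
  "lists_instance L I \<longleftrightarrow>
     distinct (map fst L) \<and> fst ` set L = nodes I \<and>
     (\<forall>(v, ps) \<in> set L. lists_family ps (families I v) (local_score I v))"

definition enc_listing :: "listing \<Rightarrow> val" where
  "enc_listing = enc_list (enc_pair enc_nat (enc_list (enc_pair (enc_list enc_nat) VReal)))"

definition enc_arcs :: "(nat \<times> nat) list \<Rightarrow> val" where
  "enc_arcs = enc_list (enc_pair enc_nat enc_nat)"

lemma lists_family_exists:
  assumes "finite F" "\<And>S. S \<in> F \<Longrightarrow> finite S" "\<And>S. S \<in> F \<Longrightarrow> \<bar>f S\<bar> \<noteq> \<infinity>"
  shows "\<exists>ps. lists_family ps F f"
proof -
  obtain Ss where Ss: "set Ss = F" "distinct Ss"
    using finite_distinct_list[OF assms(1)] by blast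
  define g where "g S = (SOME xs. set xs = S \<and> distinct xs)" for S :: "nat set"
  have g: "set (g S) = S \<and> distinct (g S)" if "S \<in> F" for S
    unfolding g_def by (rule someI_ex) (use finite_distinct_list[OF assms(2)[OF that]] in blast)
  define ps where "ps = map (\<lambda>S. (g S, real_of_ereal (f S))) Ss"
  have "map (set \<circ> fst) ps = Ss"
    using g Ss(1) by (auto simp: ps_def intro: map_idI)
  moreover have "set ` fst ` set ps = set (map (set \<circ> fst) ps)"
    by (simp add: image_comp)
  moreover have "distinct xs \<and> f (set xs) = ereal r" if "(xs, r) \<in> set ps" for xs r
    using that g Ss(1) assms(3) by (auto simp: ps_def ereal_real)
  ultimately show ?thesis
    using Ss unfolding lists_family_def by (intro exI[of _ ps]) auto
qed

lemma lists_instance_exists: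
  assumes "valid_instance k I"
  shows "\<exists>L. lists_instance L I"
proof -
  have fin: "finite (nodes I)"
    using assms by (simp add: valid_instance_def)
  then obtain vs where vs: "set vs = nodes I" "distinct vs"
    using finite_distinct_list by blast
  have "\<exists>ps. lists_family ps (families I v) (local_score I v)" if "v \<in> nodes I" for v
  proof (rule lists_family_exists)
    have sub: "families I v \<subseteq> Pow (nodes I)"
      using assms that unfolding valid_instance_def by blast
    then show "finite (families I v)"
      using fin by (meson finite_Pow_iff finite_subset)
    show "finite S" if "S \<in> families I v" for S
      using sub that fin by (auto intro: finite_subset)
    show "\<bar>local_score I v S\<bar> \<noteq> \<infinity>" if "S \<in> families I v" for S
      using assms \<open>v \<in> nodes I\<close> that by (auto simp: valid_instance_def)
  qed
  then obtain h where h: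
    "\<And>v. v \<in> nodes I \<Longrightarrow> lists_family (h v) (families I v) (local_score I v)"
    by metis
  have "lists_instance (map (\<lambda>v. (v, h v)) vs) I"
    using vs h by (auto simp: lists_instance_def comp_def image_image)
  then show ?thesis ..
qed

end

theory Submission
  imports Defs
begin

text \<open>Start from the empty graph and repeatedly add the parent set of largest positive score whose node
  has no parents yet and whose arcs close no undirected cycle. To compare with an optimal polytree
  \<open>B\<close>, maintain a polytree that contains the arcs chosen so far, initially \<open>B\<close> itself. When greedy adds
  a parent set \<open>S\<close> for \<open>v\<close>, this polytree loses its parent set of \<open>v\<close>, and for each of the at most \<open>k\<close>
  new arcs at most one cycle is closed, which is broken by dropping one further parent set. All dropped
  parent sets were available to greedy, hence score no more than \<open>S\<close>: each step is charged at
  most \<open>k + 1\<close> times its gain, and at the end nothing of positive score is left.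

  Greedy only compares scores. It is programmed by showing that the functions computable in
  polynomial time are closed under composition, pairing, case distinction and
  folds with accumulators of polynomial size. Connectivity is tracked by node labels that are
  rewritten when components merge.\<close>


section \<open>Polynomial-time functions\<close>

text \<open>Why every dropped parent set was available: the maintained polytree agrees with greedy
  at each node where greedy has chosen parents. The arc that breaks a cycle can be taken outside the
  greedy arcs, so it enters a node that is still uncommitted, and the parent set there lies together
  with the greedy arcs inside one polytree. The factor is \<open>1 + k\<close>, one loss for the old
  parent set of \<open>v\<close> and one for each new arc. Restricting greedy to positive scores
  allows fewer losses to be counted as \<open>k + 1\<close>, and it excludes the empty set, so that
  each effective step uses up a node and as many rounds as there are nodes suffice. An optimum
  scores at least as much as the empty graph, hence has only finite local scores, and the accounting
  takes place in the reals. The bound \<open>k\<close> enters this accounting only, so one program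
  serves all \<open>k\<close>.\<close>

lemma poly_nat_mono: "x \<le> y \<Longrightarrow> poly p x \<le> poly p (y :: nat)"
  by (induction p) (auto intro!: mult_mono add_mono)

lemma val_size_pos: "1 \<le> val_size x"
  by (cases x) auto

definition store :: "val \<Rightarrow> state" where
  "store x = (\<lambda>_. VNil)(0 := x)"

text \<open>The program must leave all variables except \<open>0\<close> empty, so that such programs can be
  composed by \<open>Seq\<close>.\<close>

definition ptime :: "('a \<Rightarrow> val) \<Rightarrow> ('b \<Rightarrow> val) \<Rightarrow> ('a \<Rightarrow> 'b) \<Rightarrow> bool" where
  "ptime ea eb f \<longleftrightarrow> (\<exists>c p. \<forall>a. \<exists>t \<le> poly p (val_size (ea a)).
     exec c (store (ea a)) t (store (eb (f a))))"

lemma ptimeE: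
  assumes "ptime ea eb f"
  obtains c p where "\<And>a. \<exists>t \<le> poly p (val_size (ea a)). exec c (store (ea a)) t (store (eb (f a)))"
  using assms unfolding ptime_def by blast

section \<open>Cost of expressions and size of results\<close>

lemma val_size_hd: "val_size (val_hd x) \<le> val_size x"
  by (cases x) auto

lemma val_size_tl: "val_size (val_tl x) \<le> val_size x"
  by (cases x) auto

lemma eval_le_eval_time: "val_size (eval e s) \<le> eval_time e s"
  by (cases e) auto

text \<open>Up to a constant, every operator returns a tree no larger than its operands together, so
  the factor \<open>K\<close> depends on the syntax of the expression and not on the state.\<close>

lemma eval_time_linear:
  "\<exists>K. \<forall>s M. (\<forall>x. val_size (s x) \<le> M) \<longrightarrow> eval_time e s \<le> K * M"
proof (induction e)
  case (Var x)
  show ?case by (rule exI[of _ 1]) simp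
next
  case NilE
  show ?case by (rule exI[of _ 1]) (use val_size_pos order_trans in fastforce)
next
  case ZeroE
  show ?case by (rule exI[of _ 1]) (use val_size_pos order_trans in fastforce)
next
  case (ConsE e f)
  then obtain K K' where K: "\<And>s M. (\<forall>x. val_size (s x) \<le> M) \<Longrightarrow> eval_time e s \<le> K * M"
    "\<And>s M. (\<forall>x. val_size (s x) \<le> M) \<Longrightarrow> eval_time f s \<le> K' * M" by blast
  show ?case
  proof (rule exI[of _ "1 + 2 * K + 2 * K'"], intro allI impI)
    fix s :: state and M assume M: "\<forall>x. val_size (s x) \<le> M"
    then have "1 \<le> M" using val_size_pos order_trans by blast
    then show "eval_time (ConsE e f) s \<le> (1 + 2 * K + 2 * K') * M"
      using K(1)[OF M] K(2)[OF M] eval_le_eval_time[of e s] eval_le_eval_time[of f s]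
      by (simp add: algebra_simps)
  qed
next
  case (HdE e)
  then obtain K where K: "\<And>s M. (\<forall>x. val_size (s x) \<le> M) \<Longrightarrow> eval_time e s \<le> K * M" by blast
  show ?case
  proof (rule exI[of _ "2 * K"], intro allI impI)
    fix s :: state and M assume M: "\<forall>x. val_size (s x) \<le> M"
    show "eval_time (HdE e) s \<le> 2 * K * M"
      using K[OF M] eval_le_eval_time[of e s] val_size_hd[of "eval e s"] by simp
  qed
next
  case (TlE e)
  then obtain K where K: "\<And>s M. (\<forall>x. val_size (s x) \<le> M) \<Longrightarrow> eval_time e s \<le> K * M" by blast
  show ?case
  proof (rule exI[of _ "2 * K"], intro allI impI)
    fix s :: state and M assume M: "\<forall>x. val_size (s x) \<le> M"
    show "eval_time (TlE e) s \<le> 2 * K * M"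
      using K[OF M] eval_le_eval_time[of e s] val_size_tl[of "eval e s"] by simp
  qed
next
  case (EqE e f)
  then obtain K K' where K: "\<And>s M. (\<forall>x. val_size (s x) \<le> M) \<Longrightarrow> eval_time e s \<le> K * M"
    "\<And>s M. (\<forall>x. val_size (s x) \<le> M) \<Longrightarrow> eval_time f s \<le> K' * M" by blast
  show ?case
  proof (rule exI[of _ "3 + K + K'"], intro allI impI)
    fix s :: state and M assume M: "\<forall>x. val_size (s x) \<le> M"
    then have "1 \<le> M" using val_size_pos order_trans by blast
    then show "eval_time (EqE e f) s \<le> (3 + K + K') * M"
      using K(1)[OF M] K(2)[OF M] by (simp add: algebra_simps val_bool_def)
  qed
next
  case (LessE e f)
  then obtain K K' where K: "\<And>s M. (\<forall>x. val_size (s x) \<le> M) \<Longrightarrow> eval_time e s \<le> K * M"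
    "\<And>s M. (\<forall>x. val_size (s x) \<le> M) \<Longrightarrow> eval_time f s \<le> K' * M" by blast
  show ?case
  proof (rule exI[of _ "3 + K + K'"], intro allI impI)
    fix s :: state and M assume M: "\<forall>x. val_size (s x) \<le> M"
    then have "1 \<le> M" using val_size_pos order_trans by blast
    then show "eval_time (LessE e f) s \<le> (3 + K + K') * M"
      using K(1)[OF M] K(2)[OF M] by (simp add: algebra_simps val_bool_def)
  qed
qed

text \<open>An assignment is charged at least the size of the value that it writes, so a bound on
  the time also bounds the output. Composition depends on this.\<close>

lemma exec_result_size:
  "exec c s t s' \<Longrightarrow> s' x = s x \<or> val_size (s' x) \<le> t"
proof (induction rule: exec.induct)
  case (Assign y e s)
  then show ?case using eval_le_eval_time[of e s] by auto
qed auto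

lemma ptime_result_size:
  assumes "ptime ea eb f"
  obtains p where "\<And>a. val_size (eb (f a)) \<le> poly p (val_size (ea a))"
proof -
  obtain c p where cp: "\<And>a. \<exists>t \<le> poly p (val_size (ea a)). exec c (store (ea a)) t (store (eb (f a)))"
    by (rule ptimeE[OF assms]) (rule that)
  have "val_size (eb (f a)) \<le> poly ([:0, 1:] + p) (val_size (ea a))" for a
  proof -
    obtain t where "t \<le> poly p (val_size (ea a))" "exec c (store (ea a)) t (store (eb (f a)))"
      using cp by blast
    with exec_result_size[OF this(2), of 0] show ?thesis
      by (auto simp: store_def)
  qed
  then show ?thesis by (rule that)
qed

lemma ptime_expr:
  assumes "\<And>a. eval e (store (ea a)) = eb (f a)"
  shows "ptime ea eb f"
proof -
  obtain K where K: "\<And>s M. (\<forall>x. val_size (s x) \<le> M) \<Longrightarrow> eval_time e s \<le> K * M"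
    using eval_time_linear by blast
  show ?thesis
    unfolding ptime_def
  proof (intro exI allI conjI)
    fix a
    have "eval_time e (store (ea a)) \<le> K * val_size (ea a)"
      by (rule K) (use val_size_pos[of "ea a"] in \<open>simp add: store_def\<close>)
    then show "1 + eval_time e (store (ea a)) \<le> poly [:1, K:] (val_size (ea a))"
      by (simp add: mult.commute)
    show "exec (Assign 0 e) (store (ea a)) (1 + eval_time e (store (ea a))) (store (eb (f a)))"
      using exec.Assign[of 0 e "store (ea a)"] assms[of a] by (simp add: store_def)
  qed
qed

lemma ptime_comp:
  assumes "ptime ea eb g" "ptime eb ec f"
  shows "ptime ea ec (\<lambda>x. f (g x))"
proof -
  obtain c p where c: "\<And>a. \<exists>t \<le> poly p (val_size (ea a)). exec c (store (ea a)) t (store (eb (g a)))"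
    by (rule ptimeE[OF assms(1)]) (rule that)
  obtain d q where d: "\<And>a. \<exists>t \<le> poly q (val_size (eb a)). exec d (store (eb a)) t (store (ec (f a)))"
    by (rule ptimeE[OF assms(2)]) (rule that)
  obtain r where r: "\<And>a. val_size (eb (g a)) \<le> poly r (val_size (ea a))"
    by (rule ptime_result_size[OF assms(1)]) (rule that)
  have "\<exists>t \<le> poly (1 + p + pcompose q r) (val_size (ea a)).
      exec (Seq c d) (store (ea a)) t (store (ec (f (g a))))" for a
  proof -
    obtain t where t: "t \<le> poly p (val_size (ea a))" "exec c (store (ea a)) t (store (eb (g a)))"
      using c by blast
    obtain u where u: "u \<le> poly q (val_size (eb (g a)))" "exec d (store (eb (g a))) u (store (ec (f (g a))))"
      using d by blast
    have "1 + t + u \<le> poly (1 + p + pcompose q r) (val_size (ea a))"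
      using t(1) u(1) poly_nat_mono[OF r[of a], of q] by (simp add: poly_pcompose)
    then show ?thesis using exec.Seq[OF t(2) u(2)] by blast
  qed
  then show ?thesis unfolding ptime_def by blast
qed

section \<open>Running a program beside saved data\<close>

fun rename_expr :: "(nat \<Rightarrow> nat) \<Rightarrow> expr \<Rightarrow> expr" where
  "rename_expr h (Var x) = Var (h x)"
| "rename_expr h NilE = NilE"
| "rename_expr h ZeroE = ZeroE"
| "rename_expr h (ConsE e f) = ConsE (rename_expr h e) (rename_expr h f)"
| "rename_expr h (HdE e) = HdE (rename_expr h e)"
| "rename_expr h (TlE e) = TlE (rename_expr h e)"
| "rename_expr h (EqE e f) = EqE (rename_expr h e) (rename_expr h f)"
| "rename_expr h (LessE e f) = LessE (rename_expr h e) (rename_expr h f)"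

fun rename :: "(nat \<Rightarrow> nat) \<Rightarrow> com \<Rightarrow> com" where
  "rename h Skip = Skip"
| "rename h (Assign x e) = Assign (h x) (rename_expr h e)"
| "rename h (Seq c d) = Seq (rename h c) (rename h d)"
| "rename h (Cond e c d) = Cond (rename_expr h e) (rename h c) (rename h d)"
| "rename h (While e c) = While (rename_expr h e) (rename h c)"

lemma eval_rename: "eval (rename_expr h e) s = eval e (s \<circ> h)"
  by (induction e) auto

lemma eval_time_rename: "eval_time (rename_expr h e) s = eval_time e (s \<circ> h)"
  by (induction e) (simp_all add: eval_rename comp_def)

text \<open>The renamed program touches only variables in the range of \<open>h\<close>; all others
  keep their value, which makes room for data to be saved across a run.\<close>

lemma exec_rename:
  assumes "exec c s t s'" "inj h" "\<And>x. r (h x) = s x"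
  shows "exec (rename h c) r t (\<lambda>y. if y \<in> range h then s' (inv h y) else r y)"
  using assms(1,3)
proof (induction arbitrary: r rule: exec.induct)
  case (Skip s)
  then have "(\<lambda>y. if y \<in> range h then s (inv h y) else r y) = r"
    using assms(2) by (auto simp: fun_eq_iff)
  then show ?case using exec.Skip by simp
next
  case (Assign x e s)
  then have s: "s = r \<circ> h" by (auto simp: fun_eq_iff)
  then have "(\<lambda>y. if y \<in> range h then (s(x := eval e s)) (inv h y) else r y)
    = r(h x := eval (rename_expr h e) r)"
    using assms(2) by (auto simp: fun_eq_iff[where f = "\<lambda>y. if _ y then _ y else _ y"] eval_rename inj_eq)
  then show ?case using exec.Assign[of "h x" "rename_expr h e" r] s by (simp add: eval_time_rename)
next
  case (Seq c s t s' d t' s'')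
  let ?r = "\<lambda>y. if y \<in> range h then s' (inv h y) else r y"
  have "exec (rename h d) ?r t' (\<lambda>y. if y \<in> range h then s'' (inv h y) else ?r y)"
    using Seq.IH(2)[of ?r] assms(2) by simp
  from exec.Seq[OF Seq.IH(1)[OF Seq.prems] this] show ?case
    by (simp add: if_distrib cong: if_cong)
next
  case (CondTrue e s c t s' d)
  then have s: "s = r \<circ> h" by (auto simp: fun_eq_iff)
  show ?case
    using exec.CondTrue[OF _ CondTrue.IH[OF CondTrue.prems], of "rename_expr h e" "rename h d"]
      CondTrue.hyps(1) s
    by (simp add: eval_rename eval_time_rename)
next
  case (CondFalse e s d t s' c)
  then have s: "s = r \<circ> h" by (auto simp: fun_eq_iff)
  show ?case
    using exec.CondFalse[OF _ CondFalse.IH[OF CondFalse.prems], of "rename_expr h e" "rename h c"]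
      CondFalse.hyps(1) s
    by (simp add: eval_rename eval_time_rename)
next
  case (WhileFalse e s c)
  then have s: "s = r \<circ> h" by (auto simp: fun_eq_iff)
  then have "(\<lambda>y. if y \<in> range h then s (inv h y) else r y) = r"
    using assms(2) by (auto simp: fun_eq_iff)
  then show ?case
    using exec.WhileFalse[of "rename_expr h e" r "rename h c"] WhileFalse.hyps s
    by (simp add: eval_rename eval_time_rename)
next
  case (WhileTrue e s c t s' t' s'')
  then have s: "s = r \<circ> h" by (auto simp: fun_eq_iff)
  let ?r = "\<lambda>y. if y \<in> range h then s' (inv h y) else r y"
  have "exec (rename h (While e c)) ?r t' (\<lambda>y. if y \<in> range h then s'' (inv h y) else ?r y)"
    using WhileTrue.IH(2)[of ?r] assms(2) by simp
  then have "exec (While (rename_expr h e) (rename h c)) ?r t'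
      (\<lambda>y. if y \<in> range h then s'' (inv h y) else ?r y)" by simp
  from exec.WhileTrue[OF _ WhileTrue.IH(1)[OF WhileTrue.prems] this] show ?case
    using WhileTrue.hyps(1) s
    by (simp add: if_distrib eval_rename eval_time_rename cong: if_cong)
qed

lemma exec_shift:
  assumes "exec c (store x) t (store y)"
  shows "exec (rename Suc c) ((store z)(1 := x)) t ((store z)(1 := y))"
proof -
  have "(\<lambda>i. if i \<in> range Suc then store y (inv Suc i) else ((store z)(1 := x)) i) = (store z)(1 := y)"
  proof
    fix i show "(if i \<in> range Suc then store y (inv Suc i) else ((store z)(1 := x)) i) = ((store z)(1 := y)) i"
      by (cases i) (auto simp: store_def)
  qed
  then show ?thesis
    using exec_rename[OF assms, of Suc "(store z)(1 := x)"] by (simp add: store_def)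
qed

text \<open>The program for \<open>f\<close> takes its input in variable \<open>0\<close> and may
  overwrite any other variable, so nothing can be kept beside it. Shifting its variables by
  \<open>Suc\<close> frees variable \<open>0\<close> for the first component.\<close>

lemma ptime_map_snd:
  assumes "ptime ea eb f"
  shows "ptime (enc_pair ec ea) (enc_pair ec eb) (\<lambda>z. (fst z, f (snd z)))"
proof -
  obtain c p where c: "\<And>a. \<exists>t \<le> poly p (val_size (ea a)). exec c (store (ea a)) t (store (eb (f a)))"
    by (rule ptimeE[OF assms]) (rule that)
  obtain q where q: "\<And>a. val_size (eb (f a)) \<le> poly q (val_size (ea a))"
    by (rule ptime_result_size[OF assms]) (rule that)
  let ?P = "Seq (Assign 1 (TlE (Var 0))) (Seq (Assign 0 (HdE (Var 0))) (Seq (rename Suc c)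
     (Seq (Assign 0 (ConsE (Var 0) (Var 1))) (Assign 1 NilE))))"
  have "\<exists>t \<le> poly ([:20, 10:] + p + q + q) (val_size (enc_pair ec ea z)).
      exec ?P (store (enc_pair ec ea z)) t (store (enc_pair ec eb (fst z, f (snd z))))" for z
  proof -
    let ?y = "ec (fst z)" and ?x = "ea (snd z)" and ?w = "eb (f (snd z))"
    let ?N = "val_size (enc_pair ec ea z)"
    obtain t where t: "t \<le> poly p (val_size ?x)" "exec c (store ?x) t (store ?w)"
      using c by blast
    have N: "val_size ?y + val_size ?x \<le> ?N" by (simp add: enc_pair_def)
    have "exec (Assign 1 (TlE (Var 0))) (store (VPair ?y ?x)) (2 + val_size ?y + 2 * val_size ?x)
        ((store (VPair ?y ?x))(1 := ?x))"
      using exec.Assign[of 1 "TlE (Var 0)" "store (VPair ?y ?x)"] by (simp add: store_def mult_2 ac_simps)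
    moreover have "exec (Assign 0 (HdE (Var 0))) ((store (VPair ?y ?x))(1 := ?x))
       (2 + 2 * val_size ?y + val_size ?x) ((store ?y)(1 := ?x))"
      using exec.Assign[of 0 "HdE (Var 0)" "(store (VPair ?y ?x))(1 := ?x)"]
      by (simp add: store_def mult_2 fun_upd_twist ac_simps)
    moreover have "exec (rename Suc c) ((store ?y)(1 := ?x)) t ((store ?y)(1 := ?w))"
      by (rule exec_shift[OF t(2)])
    moreover have "exec (Assign 0 (ConsE (Var 0) (Var 1))) ((store ?y)(1 := ?w))
       (2 + 2 * val_size ?y + 2 * val_size ?w) ((store (VPair ?y ?w))(1 := ?w))"
      using exec.Assign[of 0 "ConsE (Var 0) (Var 1)" "(store ?y)(1 := ?w)"]
      by (simp add: store_def mult_2 fun_upd_twist algebra_simps)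
    moreover have "exec (Assign 1 NilE) ((store (VPair ?y ?w))(1 := ?w)) 2 (store (VPair ?y ?w))"
    proof -
      have "(store (VPair ?y ?w))(1 := ?w, 1 := VNil) = store (VPair ?y ?w)"
        by (auto simp: store_def fun_eq_iff)
      then show ?thesis
        using exec.Assign[of 1 NilE "(store (VPair ?y ?w))(1 := ?w)"] by (simp add: numeral_2_eq_2)
    qed
    ultimately have "exec ?P (store (VPair ?y ?x))
       (1 + (2 + val_size ?y + 2 * val_size ?x) + (1 + (2 + 2 * val_size ?y + val_size ?x) +
        (1 + t + (1 + (2 + 2 * val_size ?y + 2 * val_size ?w) + 2)))) (store (VPair ?y ?w))"
      (is "exec _ _ ?T _")
      by (intro exec.Seq)
    moreover have "?T \<le> poly ([:20, 10:] + p + q + q) ?N"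
    proof -
      have "poly p (val_size ?x) \<le> poly p ?N" "poly q (val_size ?x) \<le> poly q ?N"
        using N by (auto intro!: poly_nat_mono)
      moreover have "poly ([:20, 10:] + p + q + q) ?N = 20 + 10 * ?N + poly p ?N + poly q ?N + poly q ?N"
        by simp
      ultimately show ?thesis using t(1) q[of "snd z"] N by linarith
    qed
    moreover have "enc_pair ec ea z = VPair ?y ?x" "enc_pair ec eb (fst z, f (snd z)) = VPair ?y ?w"
      by (simp_all add: enc_pair_def)
    ultimately show ?thesis by metis
  qed
  then show ?thesis unfolding ptime_def by blast
qed

lemma ptime_id: "ptime ea ea (\<lambda>x. x)"
  by (rule ptime_expr[of "Var 0"]) (simp add: store_def)

text \<open>The input is duplicated, \<open>g\<close> is applied to the second copy and, after a
  swap, \<open>f\<close> to the other; acting on second components is enough.\<close>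

lemma ptime_Pair:
  assumes "ptime ea eb f" "ptime ea ec g"
  shows "ptime ea (enc_pair eb ec) (\<lambda>x. (f x, g x))"
proof -
  have dup: "ptime ea (enc_pair ea ea) (\<lambda>x. (x, x))"
    by (rule ptime_expr[of "ConsE (Var 0) (Var 0)"]) (simp add: store_def enc_pair_def)
  have swap: "ptime (enc_pair e e') (enc_pair e' e) (\<lambda>z. (snd z, fst z))"
    for e :: "'x \<Rightarrow> val" and e' :: "'y \<Rightarrow> val"
    by (rule ptime_expr[of "ConsE (TlE (Var 0)) (HdE (Var 0))"]) (simp add: store_def enc_pair_def)
  from ptime_comp[OF ptime_comp[OF ptime_comp[OF ptime_comp[OF dup ptime_map_snd[OF assms(2)]] swap]
    ptime_map_snd[OF assms(1)]] swap]
  show ?thesis by simp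
qed

lemma ptime_comp2:
  assumes "ptime (enc_pair eb ec) ed (\<lambda>z. F (fst z) (snd z))" "ptime ea eb f" "ptime ea ec g"
  shows "ptime ea ed (\<lambda>x. F (f x) (g x))"
  using ptime_comp[OF ptime_Pair[OF assms(2,3)] assms(1)] by simp

lemma ptime_fst: "ptime ea (enc_pair eb ec) f \<Longrightarrow> ptime ea eb (\<lambda>x. fst (f x))"
  by (rule ptime_comp, assumption, rule ptime_expr[of "HdE (Var 0)"]) (simp add: store_def enc_pair_def)

lemma ptime_snd: "ptime ea (enc_pair eb ec) f \<Longrightarrow> ptime ea ec (\<lambda>x. snd (f x))"
  by (rule ptime_comp, assumption, rule ptime_expr[of "TlE (Var 0)"]) (simp add: store_def enc_pair_def)

lemma ptime_False: "ptime ea val_bool (\<lambda>_. False)"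
  by (rule ptime_expr[of NilE]) (simp add: val_bool_def)

lemma ptime_True: "ptime ea val_bool (\<lambda>_. True)"
  by (rule ptime_expr[of "ConsE NilE NilE"]) (simp add: val_bool_def)

lemma ptime_zero_nat: "ptime ea enc_nat (\<lambda>_. 0)"
  by (rule ptime_expr[of NilE]) (simp add: enc_nat.simps)

lemma ptime_zero_real: "ptime ea VReal (\<lambda>_. 0)"
  by (rule ptime_expr[of ZeroE]) simp

lemma ptime_Nil: "ptime ea (enc_list eb) (\<lambda>_. [])"
  by (rule ptime_expr[of NilE]) (simp add: enc_list_def)

lemma ptime_Cons:
  assumes "ptime ea eb f" "ptime ea (enc_list eb) g"
  shows "ptime ea (enc_list eb) (\<lambda>x. f x # g x)"
  by (rule ptime_comp2[OF ptime_expr[of "Var 0"] assms]) (simp add: store_def enc_pair_def enc_list_def)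

lemma ptime_eq:
  assumes "ptime ea eb f" "ptime ea eb g" "inj eb"
  shows "ptime ea val_bool (\<lambda>x. f x = g x)"
  by (rule ptime_comp2[OF ptime_expr[of "EqE (HdE (Var 0)) (TlE (Var 0))"] assms(1,2)])
    (simp add: store_def enc_pair_def inj_eq[OF assms(3)])

lemma ptime_less:
  assumes "ptime ea VReal f" "ptime ea VReal g"
  shows "ptime ea val_bool (\<lambda>x. f x < g x)"
  by (rule ptime_comp2[OF ptime_expr[of "LessE (HdE (Var 0)) (TlE (Var 0))"] assms])
    (simp add: store_def enc_pair_def)

lemma inj_enc_nat: "inj enc_nat"
proof (rule injI)
  fix m n show "enc_nat m = enc_nat n \<Longrightarrow> m = n"
  proof (induction m arbitrary: n rule: less_induct)
    case (less m)
    show ?case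
    proof (cases "m = 0 \<or> n = 0")
      case True
      then show ?thesis using less.prems by (auto simp: enc_nat.simps[of m] enc_nat.simps[of n] split: if_splits)
    next
      case False
      then have "val_bool (odd m) = val_bool (odd n)" "enc_nat (m div 2) = enc_nat (n div 2)"
        using less.prems by (auto simp: enc_nat.simps[of m] enc_nat.simps[of n])
      then have "odd m = odd n" "m div 2 = n div 2"
        using less.IH[of "m div 2"] False by (auto simp: val_bool_def split: if_splits)
      then show ?thesis by (metis div_mult_mod_eq parity_cases)
    qed
  qed
qed

lemma ptime_if:
  assumes "ptime ea val_bool b" "ptime ea eb f" "ptime ea eb g"
  shows "ptime ea eb (\<lambda>x. if b x then f x else g x)"
proof -
  obtain c p where c: "\<And>a. \<exists>t \<le> poly p (val_size (ea a)). exec c (store (ea a)) t (store (eb (f a)))"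
    by (rule ptimeE[OF assms(2)]) (rule that)
  obtain d q where d: "\<And>a. \<exists>t \<le> poly q (val_size (ea a)). exec d (store (ea a)) t (store (eb (g a)))"
    by (rule ptimeE[OF assms(3)]) (rule that)
  let ?P = "Cond (HdE (Var 0)) (Seq (Assign 0 (TlE (Var 0))) c) (Seq (Assign 0 (TlE (Var 0))) d)"
  have "\<exists>t \<le> poly ([:20, 10:] + p + q) (val_size (enc_pair val_bool ea z)).
      exec ?P (store (enc_pair val_bool ea z)) t (store (eb (if fst z then f (snd z) else g (snd z))))" for z
  proof -
    let ?y = "val_bool (fst z)" and ?x = "ea (snd z)"
    have y: "val_size ?y \<le> 3" by (simp add: val_bool_def)
    have E: "enc_pair val_bool ea z = VPair ?y ?x" by (simp add: enc_pair_def)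
    obtain t where t: "t \<le> poly p (val_size ?x)" "exec c (store ?x) t (store (eb (f (snd z))))"
      using c by blast
    obtain u where u: "u \<le> poly q (val_size ?x)" "exec d (store ?x) u (store (eb (g (snd z))))"
      using d by blast
    have A: "exec (Assign 0 (TlE (Var 0))) (store (VPair ?y ?x)) (2 + val_size ?y + 2 * val_size ?x)
        (store ?x)"
      using exec.Assign[of 0 "TlE (Var 0)" "store (VPair ?y ?x)"] by (simp add: store_def mult_2 ac_simps)
    have le: "poly p (val_size ?x) \<le> poly p (val_size (enc_pair val_bool ea z))"
      "poly q (val_size ?x) \<le> poly q (val_size (enc_pair val_bool ea z))"
      by (auto intro!: poly_nat_mono simp: enc_pair_def)
    have T: "eval_time (HdE (Var 0)) (store (VPair ?y ?x)) = 1 + 2 * val_size ?y + val_size ?x"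
      by (simp add: store_def)
    show ?thesis
    proof (cases "fst z")
      case True
      then have "exec ?P (store (VPair ?y ?x)) (1 + eval_time (HdE (Var 0)) (store (VPair ?y ?x)) +
          (1 + (2 + val_size ?y + 2 * val_size ?x) + t)) (store (eb (f (snd z))))"
        by (intro exec.CondTrue exec.Seq[OF A t(2)]) (simp add: store_def val_bool_def)
      moreover have "1 + eval_time (HdE (Var 0)) (store (VPair ?y ?x)) +
          (1 + (2 + val_size ?y + 2 * val_size ?x) + t)
          \<le> poly ([:20, 10:] + p + q) (val_size (enc_pair val_bool ea z))"
        using t(1) le y unfolding T by (simp add: enc_pair_def)
      ultimately show ?thesis unfolding E if_P[OF True] by blast
    next
      case False
      then have "exec ?P (store (VPair ?y ?x)) (1 + eval_time (HdE (Var 0)) (store (VPair ?y ?x)) +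
          (1 + (2 + val_size ?y + 2 * val_size ?x) + u)) (store (eb (g (snd z))))"
        by (intro exec.CondFalse exec.Seq[OF A u(2)]) (simp add: store_def val_bool_def)
      moreover have "1 + eval_time (HdE (Var 0)) (store (VPair ?y ?x)) +
          (1 + (2 + val_size ?y + 2 * val_size ?x) + u)
          \<le> poly ([:20, 10:] + p + q) (val_size (enc_pair val_bool ea z))"
        using u(1) le y unfolding T by (simp add: enc_pair_def)
      ultimately show ?thesis unfolding E if_not_P[OF False] by blast
    qed
  qed
  then have "ptime (enc_pair val_bool ea) eb (\<lambda>z. if fst z then f (snd z) else g (snd z))"
    unfolding ptime_def by blast
  from ptime_comp2[OF this assms(1) ptime_id] show ?thesis .
qed

lemma ptime_not:
  assumes "ptime ea val_bool b"
  shows "ptime ea val_bool (\<lambda>x. \<not> b x)"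
proof -
  have "(\<lambda>x. \<not> b x) = (\<lambda>x. if b x then False else True)" by auto
  then show ?thesis using ptime_if[OF assms ptime_False ptime_True] by simp
qed

lemma ptime_conj:
  assumes "ptime ea val_bool b" "ptime ea val_bool b'"
  shows "ptime ea val_bool (\<lambda>x. b x \<and> b' x)"
proof -
  have "(\<lambda>x. b x \<and> b' x) = (\<lambda>x. if b x then b' x else False)" by auto
  then show ?thesis using ptime_if[OF assms ptime_False] by simp
qed

lemma ptime_disj:
  assumes "ptime ea val_bool b" "ptime ea val_bool b'"
  shows "ptime ea val_bool (\<lambda>x. b x \<or> b' x)"
proof -
  have "(\<lambda>x. b x \<or> b' x) = (\<lambda>x. if b x then True else b' x)" by auto
  then show ?thesis using ptime_if[OF assms(1) ptime_True assms(2)] by simp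
qed

section \<open>Loops over lists and the list functions derived from them\<close>

lemma val_size_enc_list: "val_size (enc_list e xs) = 1 + (\<Sum>x\<leftarrow>xs. 1 + val_size (e x))"
  by (induction xs) (auto simp: enc_list_def)

lemma length_less_val_size: "length xs < val_size (enc_list e xs)"
  by (induction xs) (auto simp: enc_list_def)

lemma val_size_elem: "x \<in> set xs \<Longrightarrow> val_size (e x) < val_size (enc_list e xs)"
  by (induction xs) (auto simp: enc_list_def)

lemma val_size_enc_list_le:
  "(\<And>x. x \<in> set xs \<Longrightarrow> val_size (e x) \<le> B) \<Longrightarrow> val_size (enc_list e xs) \<le> 1 + length xs * (1 + B)"
  by (induction xs) (force simp: enc_list_def)+

text \<open>The loop keeps its whole state \<open>((a, s), xs)\<close> in variable \<open>0\<close>,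
  and \<open>N\<close> bounds its size in every round. The bound \<open>M\<close> on the accumulator
  is required for all prefixes, which is what the induction hands on to the tail.\<close>

lemma exec_fold_loop:
  assumes body: "\<And>z. \<exists>t \<le> poly p (val_size (enc_pair (enc_pair ea es) (enc_pair ex (enc_list ex)) z)).
      exec c (store (enc_pair (enc_pair ea es) (enc_pair ex (enc_list ex)) z)) t
        (store (enc_pair (enc_pair ea es) (enc_list ex)
          ((fst (fst z), h (fst (fst z)) (snd (fst z)) (fst (snd z))), snd (snd z))))"
    and bound: "\<And>ys zs. xs = ys @ zs \<Longrightarrow> val_size (es (foldl (h a) s ys)) \<le> M"
    and N: "2 + val_size (ea a) + M + val_size (enc_list ex xs) \<le> N"
  shows "\<exists>t \<le> (1 + length xs) * (1 + 2 * N + poly p N).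
    exec (While (TlE (Var 0)) c) (store (enc_pair (enc_pair ea es) (enc_list ex) ((a, s), xs))) t
      (store (enc_pair (enc_pair ea es) (enc_list ex) ((a, foldl (h a) s xs), [])))"
  using bound N
proof (induction xs arbitrary: s)
  case Nil
  let ?S = "store (enc_pair (enc_pair ea es) (enc_list ex) ((a, s), []))"
  have "val_size (es s) \<le> M" using Nil.prems(1)[of "[]" "[]"] by simp
  then have "1 + eval_time (TlE (Var 0)) ?S \<le> 1 + 2 * N + poly p N"
    using Nil.prems(2) by (simp add: store_def enc_pair_def enc_list_def)
  moreover have "exec (While (TlE (Var 0)) c) ?S (1 + eval_time (TlE (Var 0)) ?S) ?S"
    by (rule exec.WhileFalse) (simp add: store_def enc_pair_def enc_list_def)
  ultimately show ?case by auto
next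
  case (Cons x xs)
  let ?S = "store (enc_pair (enc_pair ea es) (enc_list ex) ((a, s), x # xs))"
  have s: "val_size (es s) \<le> M" using Cons.prems(1)[of "[]" "x # xs"] by simp
  \<comment> \<open>A nonempty list is encoded exactly as the pair of its head and tail, so the body
    can be a total function on pairs.\<close>
  have eq: "enc_pair (enc_pair ea es) (enc_list ex) ((a, s), x # xs)
      = enc_pair (enc_pair ea es) (enc_pair ex (enc_list ex)) ((a, s), (x, xs))"
    by (simp add: enc_pair_def enc_list_def)
  have szN: "val_size (enc_pair (enc_pair ea es) (enc_list ex) ((a, s), x # xs)) \<le> N"
    using s Cons.prems(2) by (simp add: enc_pair_def)
  obtain t where t: "t \<le> poly p (val_size (enc_pair (enc_pair ea es) (enc_list ex) ((a, s), x # xs)))"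
    "exec c ?S t (store (enc_pair (enc_pair ea es) (enc_list ex) ((a, h a s x), xs)))"
    using body[of "((a, s), (x, xs))"] unfolding eq by auto
  have "val_size (es (foldl (h a) (h a s x) ys)) \<le> M" if "xs = ys @ zs" for ys zs
    using Cons.prems(1)[of "x # ys" zs] that by simp
  moreover have "2 + val_size (ea a) + M + val_size (enc_list ex xs) \<le> N"
    using Cons.prems(2) by (simp add: enc_list_def)
  ultimately obtain u where u: "u \<le> (1 + length xs) * (1 + 2 * N + poly p N)"
    "exec (While (TlE (Var 0)) c) (store (enc_pair (enc_pair ea es) (enc_list ex) ((a, h a s x), xs))) u
      (store (enc_pair (enc_pair ea es) (enc_list ex) ((a, foldl (h a) (h a s x) xs), [])))"
    using Cons.IH by blast
  have "exec (While (TlE (Var 0)) c) ?S (1 + eval_time (TlE (Var 0)) ?S + t + u)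
      (store (enc_pair (enc_pair ea es) (enc_list ex) ((a, foldl (h a) (h a s x) xs), [])))"
    by (rule exec.WhileTrue[OF _ t(2) u(2)]) (simp add: store_def enc_pair_def enc_list_def)
  moreover have "eval_time (TlE (Var 0)) ?S \<le> 2 * N"
  proof -
    have "eval_time (TlE (Var 0)) ?S \<le> 2 * val_size (enc_pair (enc_pair ea es) (enc_list ex) ((a, s), x # xs))"
      by (simp add: store_def enc_pair_def)
    then show ?thesis using szN by linarith
  qed
  then have "1 + eval_time (TlE (Var 0)) ?S + t + u \<le> (1 + length (x # xs)) * (1 + 2 * N + poly p N)"
    using t(1) u(1) poly_nat_mono[OF szN, of p] by (simp add: algebra_simps)
  ultimately show ?case by (metis foldl_Cons)
qed

text \<open>Bounded recursion: the size of the intermediate results has to be bounded in advance, since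
  iterating a step that doubles its accumulator is not polynomial.\<close>

lemma ptime_foldl:
  assumes "ptime (enc_pair (enc_pair ea es) ex) es (\<lambda>z. h (fst (fst z)) (snd (fst z)) (snd z))"
    and "ptime ea es i" "ptime ea (enc_list ex) l"
    and bound: "\<And>a ys zs. l a = ys @ zs \<Longrightarrow> val_size (es (foldl (h a) (i a) ys)) \<le> poly q (val_size (ea a))"
  shows "ptime ea es (\<lambda>a. foldl (h a) (i a) (l a))"
proof -
  let ?e = "enc_pair (enc_pair ea es) (enc_pair ex (enc_list ex))"
  let ?e' = "enc_pair (enc_pair ea es) (enc_list ex)"
  have "ptime ?e (enc_pair (enc_pair ea es) ex) (\<lambda>z. (fst z, fst (snd z)))"
    by (rule ptime_Pair ptime_id ptime_fst ptime_snd)+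
  from ptime_comp[OF this assms(1)]
  have step: "ptime ?e es (\<lambda>z. h (fst (fst z)) (snd (fst z)) (fst (snd z)))" by simp
  have "ptime ?e ?e' (\<lambda>z. ((fst (fst z), h (fst (fst z)) (snd (fst z)) (fst (snd z))), snd (snd z)))"
    by (rule ptime_Pair step ptime_id ptime_fst ptime_snd)+
  then obtain c p where c: "\<And>z. \<exists>t \<le> poly p (val_size (?e z)). exec c (store (?e z)) t
      (store (?e' ((fst (fst z), h (fst (fst z)) (snd (fst z)) (fst (snd z))), snd (snd z))))"
    by (rule ptimeE) (rule that)
  have "ptime ea ?e' (\<lambda>a. ((a, i a), l a))"
    by (intro ptime_Pair ptime_id assms)
  then obtain d r where d: "\<And>a. \<exists>t \<le> poly r (val_size (ea a)). exec d (store (ea a)) t (store (?e' ((a, i a), l a)))"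
    by (rule ptimeE) (rule that)
  obtain m where m: "\<And>a. val_size (enc_list ex (l a)) \<le> poly m (val_size (ea a))"
    by (rule ptime_result_size[OF assms(3)]) (rule that)
  define n where "n = [:2, 1:] + q + m"
  let ?P = "Seq d (While (TlE (Var 0)) c)"
  have "\<exists>t \<le> poly (1 + r + (1 + m) * (1 + 2 * n + pcompose p n)) (val_size (ea a)).
      exec ?P (store (ea a)) t (store (?e' ((a, foldl (h a) (i a) (l a)), [])))" for a
  proof -
    let ?x = "val_size (ea a)"
    obtain t where t: "t \<le> poly r ?x" "exec d (store (ea a)) t (store (?e' ((a, i a), l a)))"
      using d by blast
    have "\<exists>t \<le> (1 + length (l a)) * (1 + 2 * poly n ?x + poly p (poly n ?x)).
      exec (While (TlE (Var 0)) c) (store (?e' ((a, i a), l a))) t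
        (store (?e' ((a, foldl (h a) (i a) (l a)), [])))"
      by (rule exec_fold_loop[where M = "poly q ?x", OF c bound])
        (use m[of a] in \<open>auto simp: n_def\<close>)
    then obtain u where u: "u \<le> (1 + length (l a)) * (1 + 2 * poly n ?x + poly p (poly n ?x))"
      "exec (While (TlE (Var 0)) c) (store (?e' ((a, i a), l a))) u
        (store (?e' ((a, foldl (h a) (i a) (l a)), [])))" by blast
    have "length (l a) \<le> poly m ?x"
      using m[of a] length_less_val_size[of "l a" ex] by linarith
    then have "(1 + length (l a)) * (1 + 2 * poly n ?x + poly p (poly n ?x))
      \<le> (1 + poly m ?x) * (1 + 2 * poly n ?x + poly p (poly n ?x))"
      by (intro mult_mono) auto
    then have "1 + t + u \<le> poly (1 + r + (1 + m) * (1 + 2 * n + pcompose p n)) ?x"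
      using t(1) u(1) by (simp add: poly_pcompose)
    then show ?thesis using exec.Seq[OF t(2) u(2)] by blast
  qed
  then have "ptime ea ?e' (\<lambda>a. ((a, foldl (h a) (i a) (l a)), []))"
    unfolding ptime_def by blast
  from ptime_snd[OF ptime_fst[OF this]] show ?thesis by simp
qed

text \<open>The accumulator is always the default or an entry of the list, so its size is bounded
  whatever \<open>b\<close> is. Looking up a label and searching for the best candidate both have
  this shape.\<close>

lemma ptime_select:
  assumes "ptime (enc_pair (enc_pair ea ex) ex) val_bool (\<lambda>z. b (fst (fst z)) (snd (fst z)) (snd z))"
    and "ptime ea ex d" "ptime ea (enc_list ex) l"
  shows "ptime ea ex (\<lambda>a. foldl (\<lambda>r x. if b a r x then x else r) (d a) (l a))"
proof -
  obtain p where p: "\<And>a. val_size (ex (d a)) \<le> poly p (val_size (ea a))"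
    by (rule ptime_result_size[OF assms(2)]) (rule that)
  obtain q where q: "\<And>a. val_size (enc_list ex (l a)) \<le> poly q (val_size (ea a))"
    by (rule ptime_result_size[OF assms(3)]) (rule that)
  have in_set: "foldl (\<lambda>r x. if b a r x then x else r) s xs \<in> insert s (set xs)" for a s xs
    by (induction xs arbitrary: s) auto
  show ?thesis
  proof (rule ptime_foldl[where q = "p + q" and h = "\<lambda>a r x. if b a r x then x else r", OF _ assms(2,3)])
    show "ptime (enc_pair (enc_pair ea ex) ex) ex
      (\<lambda>z. if b (fst (fst z)) (snd (fst z)) (snd z) then snd z else snd (fst z))"
      by (rule ptime_if assms(1) ptime_id ptime_fst ptime_snd)+
    fix a ys zs assume l: "l a = ys @ zs"
    let ?f = "foldl (\<lambda>r x. if b a r x then x else r) (d a) ys"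
    have "?f = d a \<or> ?f \<in> set (l a)" using in_set[of a "d a" ys] l by auto
    then show "val_size (ex ?f) \<le> poly (p + q) (val_size (ea a))"
    proof
      assume "?f \<in> set (l a)"
      from val_size_elem[OF this, of ex] q[of a] show ?thesis by simp
    qed (use p[of a] in simp)
  qed
qed

lemma ptime_rev_append:
  assumes "ptime ea (enc_list eb) f" "ptime ea (enc_list eb) g"
  shows "ptime ea (enc_list eb) (\<lambda>a. rev (f a) @ g a)"
proof -
  obtain p where p: "\<And>a. val_size (enc_list eb (f a)) \<le> poly p (val_size (ea a))"
    by (rule ptime_result_size[OF assms(1)]) (rule that)
  obtain q where q: "\<And>a. val_size (enc_list eb (g a)) \<le> poly q (val_size (ea a))"
    by (rule ptime_result_size[OF assms(2)]) (rule that)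
  have fold: "foldl (\<lambda>s x. x # s) s xs = rev xs @ s" for s xs :: "'b list"
    by (induction xs arbitrary: s) auto
  have "ptime ea (enc_list eb) (\<lambda>a. foldl (\<lambda>s x. x # s) (g a) (f a))"
  proof (rule ptime_foldl[where q = "p + q", OF _ assms(2,1)])
    show "ptime (enc_pair (enc_pair ea (enc_list eb)) eb) (enc_list eb) (\<lambda>z. snd z # snd (fst z))"
      by (rule ptime_Cons ptime_id ptime_fst ptime_snd)+
    fix a ys zs assume "f a = ys @ zs"
    then have "val_size (enc_list eb ys) \<le> poly p (val_size (ea a))"
      using p[of a] by (simp add: val_size_enc_list)
    then show "val_size (enc_list eb (foldl (\<lambda>s x. x # s) (g a) ys)) \<le> poly (p + q) (val_size (ea a))"
      using q[of a] unfolding fold by (simp add: val_size_enc_list rev_map[symmetric])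
  qed
  then show ?thesis unfolding fold .
qed

lemma ptime_rev: "ptime ea (enc_list eb) f \<Longrightarrow> ptime ea (enc_list eb) (\<lambda>a. rev (f a))"
  using ptime_rev_append[OF _ ptime_Nil] by simp

lemma ptime_append:
  "ptime ea (enc_list eb) f \<Longrightarrow> ptime ea (enc_list eb) g \<Longrightarrow> ptime ea (enc_list eb) (\<lambda>a. f a @ g a)"
  using ptime_rev_append[OF ptime_rev] by simp

lemma ptime_map:
  assumes "ptime (enc_pair ea eb) ec (\<lambda>z. f (fst z) (snd z))" "ptime ea (enc_list eb) l"
  shows "ptime ea (enc_list ec) (\<lambda>a. map (f a) (l a))"
proof -
  obtain p where p: "\<And>z. val_size (ec (f (fst z) (snd z))) \<le> poly p (val_size (enc_pair ea eb z))"
    by (rule ptime_result_size[OF assms(1)]) (rule that)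
  obtain q where q: "\<And>a. val_size (enc_list eb (l a)) \<le> poly q (val_size (ea a))"
    by (rule ptime_result_size[OF assms(2)]) (rule that)
  have fold: "foldl (\<lambda>s x. f a x # s) s xs = rev (map (f a) xs) @ s" for s xs a
    by (induction xs arbitrary: s) auto
  have "ptime ea (enc_list ec) (\<lambda>a. foldl (\<lambda>s x. f a x # s) [] (l a))"
  \<comment> \<open>At most \<open>q\<close> entries, each with one list cell and of the size that
    \<open>f\<close> can produce from \<open>a\<close> paired with an entry of
    \<open>l a\<close>.\<close>
  proof (rule ptime_foldl[where q = "1 + q * (1 + pcompose p ([:1, 1:] + q))" and h = "\<lambda>a s x. f a x # s",
        OF _ ptime_Nil assms(2)])
    have "ptime (enc_pair (enc_pair ea (enc_list ec)) eb) (enc_pair ea eb) (\<lambda>z. (fst (fst z), snd z))"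
      by (rule ptime_id ptime_Pair ptime_fst ptime_snd)+
    from ptime_comp[OF this assms(1)]
    have "ptime (enc_pair (enc_pair ea (enc_list ec)) eb) ec (\<lambda>z. f (fst (fst z)) (snd z))" by simp
    then show "ptime (enc_pair (enc_pair ea (enc_list ec)) eb) (enc_list ec)
      (\<lambda>z. f (fst (fst z)) (snd z) # snd (fst z))"
      by (intro ptime_Cons ptime_fst[OF ptime_id] ptime_snd[OF ptime_fst[OF ptime_id]])
    fix a ys zs assume l: "l a = ys @ zs"
    let ?x = "val_size (ea a)"
    let ?B = "poly p (1 + ?x + poly q ?x)"
    have "val_size (ec (f a y)) \<le> ?B" if "y \<in> set ys" for y
    proof -
      have "val_size (enc_pair ea eb (a, y)) \<le> 1 + ?x + poly q ?x"
        using val_size_elem[of y "l a" eb] that l q[of a] by (simp add: enc_pair_def)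
      from poly_nat_mono[OF this, of p] p[of "(a, y)"] show ?thesis by simp
    qed
    then have "val_size (enc_list ec (rev (map (f a) ys))) \<le> 1 + length (rev (map (f a) ys)) * (1 + ?B)"
      by (intro val_size_enc_list_le) auto
    also have "\<dots> \<le> 1 + poly q ?x * (1 + ?B)"
      using length_less_val_size[of "l a" eb] q[of a] l by (intro add_mono mult_mono) auto
    finally show "val_size (enc_list ec (foldl (\<lambda>s x. f a x # s) [] ys))
        \<le> poly (1 + q * (1 + pcompose p ([:1, 1:] + q))) ?x"
      unfolding fold by (simp add: poly_pcompose)
  qed
  from ptime_rev[OF this] show ?thesis unfolding fold by simp
qed

lemma ptime_concat:
  assumes "ptime ea (enc_list (enc_list eb)) l"
  shows "ptime ea (enc_list eb) (\<lambda>a. concat (l a))"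
proof -
  obtain q where q: "\<And>a. val_size (enc_list (enc_list eb) (l a)) \<le> poly q (val_size (ea a))"
    by (rule ptime_result_size[OF assms]) (rule that)
  have fold: "foldl (@) s xss = s @ concat xss" for s :: "'b list" and xss
    by (induction xss arbitrary: s) auto
  have size: "val_size (enc_list eb (concat xss)) \<le> val_size (enc_list (enc_list eb) xss)" for xss
    by (induction xss) (auto simp: val_size_enc_list)
  have "ptime ea (enc_list eb) (\<lambda>a. foldl (@) [] (l a))"
  proof (rule ptime_foldl[where q = q, OF _ ptime_Nil assms])
    show "ptime (enc_pair (enc_pair ea (enc_list eb)) (enc_list eb)) (enc_list eb) (\<lambda>z. snd (fst z) @ snd z)"
      by (rule ptime_append ptime_id ptime_fst ptime_snd)+
    fix a ys zs assume "l a = ys @ zs"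
    then have "val_size (enc_list (enc_list eb) ys) \<le> poly q (val_size (ea a))"
      using q[of a] by (simp add: val_size_enc_list)
    then show "val_size (enc_list eb (foldl (@) [] ys)) \<le> poly q (val_size (ea a))"
      using size[of ys] unfolding fold by simp
  qed
  then show ?thesis unfolding fold by simp
qed

lemma ptime_Ball:
  assumes "ptime (enc_pair ea eb) val_bool (\<lambda>z. f (fst z) (snd z))" "ptime ea (enc_list eb) l"
  shows "ptime ea val_bool (\<lambda>a. \<forall>x \<in> set (l a). f a x)"
proof -
  have fold: "foldl (\<lambda>s x. s \<and> f a x) s xs = (s \<and> (\<forall>x \<in> set xs. f a x))" for s xs a
    by (induction xs arbitrary: s) auto
  have "ptime ea val_bool (\<lambda>a. foldl (\<lambda>s x. s \<and> f a x) True (l a))"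
  proof (rule ptime_foldl[where q = 3 and h = "\<lambda>a s x. s \<and> f a x", OF _ ptime_True assms(2)])
    have "ptime (enc_pair (enc_pair ea val_bool) eb) (enc_pair ea eb) (\<lambda>z. (fst (fst z), snd z))"
      by (rule ptime_id ptime_Pair ptime_fst ptime_snd)+
    from ptime_comp[OF this assms(1)]
    have "ptime (enc_pair (enc_pair ea val_bool) eb) val_bool (\<lambda>z. f (fst (fst z)) (snd z))" by simp
    then show "ptime (enc_pair (enc_pair ea val_bool) eb) val_bool
        (\<lambda>z. snd (fst z) \<and> f (fst (fst z)) (snd z))"
      by (intro ptime_conj ptime_snd[OF ptime_fst[OF ptime_id]])
  qed (simp add: val_bool_def)
  then show ?thesis unfolding fold by simp
qed

lemma ptime_Bex:
  assumes "ptime (enc_pair ea eb) val_bool (\<lambda>z. f (fst z) (snd z))" "ptime ea (enc_list eb) l"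
  shows "ptime ea val_bool (\<lambda>a. \<exists>x \<in> set (l a). f a x)"
  using ptime_not[OF ptime_Ball[OF ptime_not[OF assms(1)] assms(2)]] by simp

lemmas ptime_intros = ptime_id ptime_Pair ptime_fst ptime_snd ptime_False ptime_True ptime_zero_nat
  ptime_zero_real ptime_Nil ptime_Cons ptime_eq inj_enc_nat ptime_less ptime_if ptime_not ptime_conj
  ptime_disj ptime_append ptime_map ptime_concat ptime_Ball ptime_Bex


section \<open>Polytrees and bridges\<close>

definition conn :: "('a \<times> 'a) set \<Rightarrow> ('a \<times> 'a) set" where
  "conn A = (A \<union> A\<inverse>)\<^sup>*"

text \<open>Since the skeleton identifies antiparallel arcs and turns a loop into a singleton, being a forest
  does not exclude either. Counting arcs rather than edges, a loop and each of two antiparallel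
  arcs fail to be bridges, so a single condition covers both parts of the definition of a polytree.\<close>

definition bridges :: "('a \<times> 'a) set \<Rightarrow> bool" where
  "bridges A \<longleftrightarrow> (\<forall>(a, b) \<in> A. (a, b) \<notin> conn (A - {(a, b)}))"

lemma conn_refl: "(x, x) \<in> conn A"
  by (simp add: conn_def)

lemma conn_sym: "(x, y) \<in> conn A \<Longrightarrow> (y, x) \<in> conn A"
  unfolding conn_def by (rule symD[OF sym_rtrancl[OF sym_Un_converse]])

lemma conn_trans: "(x, y) \<in> conn A \<Longrightarrow> (y, z) \<in> conn A \<Longrightarrow> (x, z) \<in> conn A"
  unfolding conn_def by (rule rtrancl_trans)

lemma conn_arc: "(x, y) \<in> A \<Longrightarrow> (x, y) \<in> conn A"
  unfolding conn_def by blast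

lemma conn_mono: "A \<subseteq> B \<Longrightarrow> (x, y) \<in> conn A \<Longrightarrow> (x, y) \<in> conn B"
  unfolding conn_def by (rule subsetD[OF rtrancl_mono]) auto

lemma conn_least:
  assumes "(x, y) \<in> conn A" "\<And>u v. (u, v) \<in> A \<Longrightarrow> f u = f v"
  shows "f x = f y"
  using assms(1) unfolding conn_def by (induction rule: rtrancl_induct) (use assms(2) in force)+

text \<open>A walk can be shortened until it crosses the new arc at most once; the last two cases
  are the two directions of crossing.\<close>

lemma conn_insert:
  assumes "(x, y) \<in> conn (insert (a, b) A)"
  shows "(x, y) \<in> conn A \<or> (x, a) \<in> conn A \<and> (b, y) \<in> conn A \<or> (x, b) \<in> conn A \<and> (a, y) \<in> conn A"
  using assms unfolding conn_def[of "insert (a, b) A"]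
proof (induction rule: rtrancl_induct)
  case base
  show ?case by (simp add: conn_refl)
next
  case (step y z)
  from step.hyps(2) consider "(y, z) \<in> conn A" | "y = a" "z = b" | "y = b" "z = a"
    by (auto dest: conn_arc intro: conn_sym)
  then show ?case
  proof cases
    case 1
    with step.IH conn_trans[OF _ 1] show ?thesis by blast
  next
    case 2
    with step.IH conn_refl[of b] conn_sym[of b a] conn_trans[of x b A a] show ?thesis by blast
  next
    case 3
    with step.IH conn_refl[of a] conn_sym[of a b] conn_trans[of x a A b] show ?thesis by blast
  qed
qed

lemma bridges_mono:
  assumes "A \<subseteq> B" "bridges B"
  shows "bridges A"
  unfolding bridges_def
proof safe
  fix a b assume "(a, b) \<in> A" "(a, b) \<in> conn (A - {(a, b)})"
  moreover have "A - {(a, b)} \<subseteq> B - {(a, b)}" using assms(1) by blast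
  ultimately have "(a, b) \<in> B" "(a, b) \<in> conn (B - {(a, b)})"
    using assms(1) conn_mono[of "A - {(a, b)}" "B - {(a, b)}"] by auto
  then show False using assms(2) unfolding bridges_def by auto
qed

text \<open>If an old arc \<open>(a, b)\<close> stopped being a bridge, the detour around it would
  cross \<open>(u, v)\<close>; the rest of the detour together with \<open>(a, b)\<close> would join
  \<open>u\<close> and \<open>v\<close> inside \<open>A\<close>.\<close>

lemma bridges_insert:
  assumes "bridges A" "(u, v) \<notin> conn A"
  shows "bridges (insert (u, v) A)"
  unfolding bridges_def
proof safe
  fix a b
  assume "(u, v) \<in> conn (insert (u, v) A - {(u, v)})"
  then show False using assms(2) conn_mono[of "insert (u, v) A - {(u, v)}" A] by blast
next
  fix a b
  assume ab: "(a, b) \<in> A" and c: "(a, b) \<in> conn (insert (u, v) A - {(a, b)})"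
  have ne: "(a, b) \<noteq> (u, v)" using conn_arc[OF ab] assms(2) by auto
  let ?B = "A - {(a, b)}"
  have "insert (u, v) A - {(a, b)} = insert (u, v) ?B" using ne by auto
  with c have "(a, b) \<in> conn ?B \<or> (a, u) \<in> conn ?B \<and> (v, b) \<in> conn ?B
      \<or> (a, v) \<in> conn ?B \<and> (u, b) \<in> conn ?B"
    using conn_insert[of a b u v ?B] by simp
  moreover have "(a, b) \<notin> conn ?B" using assms(1) ab unfolding bridges_def by blast
  moreover have "(x, y) \<in> conn ?B \<Longrightarrow> (x, y) \<in> conn A" for x y
    by (rule conn_mono[of ?B]) auto
  ultimately have "(a, u) \<in> conn A \<and> (v, b) \<in> conn A \<or> (a, v) \<in> conn A \<and> (u, b) \<in> conn A"
    by blast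
  then show False using conn_arc[OF ab] assms(2) by (meson conn_sym conn_trans)
qed

text \<open>Arcs are added one by one. A directed cycle through the last arc \<open>(u, v)\<close>
  contains a directed path from \<open>v\<close> to \<open>u\<close>, which joins its ends without
  it.\<close>

lemma bridges_imp_acyclic:
  assumes "finite A" "bridges A"
  shows "acyclic A"
  using assms
proof (induction A rule: finite_induct)
  case empty
  show ?case by (simp add: acyclic_def)
next
  case (insert e A)
  obtain u v where e: "e = (u, v)" by fastforce
  have "insert (u, v) A - {(u, v)} = A" using insert.hyps(2) e by auto
  then have "(u, v) \<notin> conn A" using insert.prems e unfolding bridges_def by auto
  then have "(v, u) \<notin> A\<^sup>*"
    by (metis Un_upper1 conn_def conn_sym rtrancl_mono subsetD)
  moreover have "acyclic A"
    using insert.IH insert.prems bridges_mono by blast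
  ultimately show ?case using e by (simp)
qed

text \<open>The arc behind the closing edge of a cycle has a detour along the remaining edges, so it
  is not a bridge.\<close>

lemma bridges_imp_forest:
  assumes "bridges A"
  shows "forest (skeleton A)"
  unfolding forest_def
proof
  assume "\<exists>c. ugraph_cycle (skeleton A) c"
  then obtain c where c: "3 \<le> length c" "distinct c"
    and E: "\<And>i. i < length c \<Longrightarrow> {c ! i, c ! (Suc i mod length c)} \<in> skeleton A"
    unfolding ugraph_cycle_def by blast
  define m where "m = length c - 1"
  have m: "m < length c" "2 \<le> m" "Suc m = length c" using c(1) by (auto simp: m_def)
  obtain a b where ab: "(a, b) \<in> A" "{a, b} = {c ! m, c ! 0}"
    using E[OF m(1)] m(3) by (auto simp: skeleton_def)
  let ?B = "A - {(a, b)}"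
  have "(c ! 0, c ! i) \<in> conn ?B" if "i \<le> m" for i
    using that
  proof (induction i)
    case (Suc i)
    have lt: "i < length c" "Suc i < length c" using Suc.prems m by auto
    then obtain x y where xy: "(x, y) \<in> A" "{x, y} = {c ! i, c ! Suc i}"
      using E[of i] by (auto simp: skeleton_def)
    \<comment> \<open>Length at least 3 is essential here: on two nodes the other edge would be the
      closing edge itself.\<close>
    have "{c ! i, c ! Suc i} \<noteq> {c ! m, c ! 0}"
      using lt m le_less_trans[OF le0 lt(1)] nth_eq_iff_index_eq[OF c(2), of i 0] nth_eq_iff_index_eq[OF c(2), of "Suc i" 0]
        nth_eq_iff_index_eq[OF c(2), of i m] nth_eq_iff_index_eq[OF c(2), of "Suc i" m]
      by (auto simp: doubleton_eq_iff)
    then have "(x, y) \<in> ?B" using xy ab by auto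
    then have "(c ! i, c ! Suc i) \<in> conn ?B"
      using xy(2) by (auto simp: doubleton_eq_iff intro: conn_arc conn_sym)
    with Suc show ?case by (auto intro: conn_trans)
  qed (simp add: conn_refl)
  then have "(c ! 0, c ! m) \<in> conn ?B" by blast
  then have "(a, b) \<in> conn ?B" using ab(2) by (auto simp: doubleton_eq_iff intro: conn_sym)
  then show False using assms ab(1) unfolding bridges_def by blast
qed

text \<open>Cycles are lists of distinct nodes, so a detour around an arc has to be made a path:
  when the walk returns to a node of the path, the path is cut back to that node.\<close>

lemma conn_simple_path:
  assumes "(x, y) \<in> conn A"
  shows "\<exists>p. p \<noteq> [] \<and> hd p = x \<and> last p = y \<and> distinct p \<and>
    (\<forall>i. Suc i < length p \<longrightarrow> (p ! i, p ! Suc i) \<in> A \<union> A\<inverse>)"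
  using assms unfolding conn_def
proof (induction rule: rtrancl_induct)
  case base
  show ?case by (rule exI[of _ "[x]"]) simp
next
  case (step y z)
  then obtain p where p: "p \<noteq> []" "hd p = x" "last p = y" "distinct p"
    "\<And>i. Suc i < length p \<Longrightarrow> (p ! i, p ! Suc i) \<in> A \<union> A\<inverse>" by blast
  show ?case
  proof (cases "z \<in> set p")
    case True
    then obtain j where j: "j < length p" "p ! j = z" by (auto simp: in_set_conv_nth)
    let ?q = "take (Suc j) p"
    have "?q \<noteq> []" "hd ?q = x" "distinct ?q" using p by simp_all
    moreover have "last ?q = z" using j by (simp add: take_Suc_conv_app_nth)
    moreover have "(?q ! i, ?q ! Suc i) \<in> A \<union> A\<inverse>" if "Suc i < length ?q" for i
      using p(5)[of i] that by auto
    ultimately show ?thesis by blast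
  next
    case False
    have "((p @ [z]) ! i, (p @ [z]) ! Suc i) \<in> A \<union> A\<inverse>" if "Suc i < length (p @ [z])" for i
    proof (cases "Suc i < length p")
      case True
      then show ?thesis using p(5)[of i] by (simp add: nth_append)
    next
      case F: False
      then have "i = length p - 1" "i < length p" "Suc i = length p" using that p(1) by (auto simp: Suc_lessI)
      then show ?thesis using p(1,3) step.hyps(2) by (simp add: nth_append last_conv_nth)
    qed
    with p False show ?thesis by (intro exI[of _ "p @ [z]"]) simp
  qed
qed

text \<open>A simple detour around \<open>(a, b)\<close> closes to an undirected cycle unless it has
  at most two nodes. One node means a loop and two nodes the reverse arc \<open>(b, a)\<close>;
  acyclicity excludes both.\<close>

lemma polytree_imp_bridges:
  assumes "polytree V A"
  shows "bridges A"
  unfolding bridges_def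
proof safe
  fix a b assume ab: "(a, b) \<in> A" and c: "(a, b) \<in> conn (A - {(a, b)})"
  have ac: "acyclic A" and fo: "forest (skeleton A)"
    using assms by (auto simp: polytree_def dag_def)
  let ?B = "A - {(a, b)}"
  obtain p where p: "p \<noteq> []" "hd p = a" "last p = b" "distinct p"
    "\<And>i. Suc i < length p \<Longrightarrow> (p ! i, p ! Suc i) \<in> ?B \<union> ?B\<inverse>"
    using conn_simple_path[OF c] by blast
  have a: "p ! 0 = a" and b: "p ! (length p - 1) = b"
    using p by (auto simp: hd_conv_nth last_conv_nth)
  have "a \<noteq> b" using ac ab unfolding acyclic_def by blast
  then have "length p \<noteq> 1" "length p \<noteq> 0" using a b p(1) by auto
  moreover have "length p \<noteq> 2"
  proof
    assume "length p = 2"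
    then have "(b, a) \<in> A" using p(5)[of 0] a b by auto
    then show False using ab ac unfolding acyclic_def by (meson trancl.intros)
  qed
  ultimately have len: "3 \<le> length p" by linarith
  have "{p ! i, p ! (Suc i mod length p)} \<in> skeleton A" if "i < length p" for i
  proof (cases "Suc i < length p")
    case True
    then show ?thesis using p(5)[of i] by (auto simp: skeleton_def insert_commute)
  next
    case False
    then have "Suc i = length p" "i = length p - 1" using that by auto
    then show ?thesis using a b ab by (auto simp: skeleton_def insert_commute)
  qed
  with len p(4) have "ugraph_cycle (skeleton A) p" by (simp add: ugraph_cycle_def)
  then show False using fo unfolding forest_def by blast
qed

lemma polytree_iff_bridges:
  assumes "finite V"
  shows "polytree V A \<longleftrightarrow> A \<subseteq> V \<times> V \<and> bridges A"
  using assms polytree_imp_bridges[of V A] bridges_imp_forest bridges_imp_acyclic[of A]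
    finite_subset[of A "V \<times> V"]
  by (auto simp: polytree_def dag_def)

section \<open>The exchange argument\<close>

lemma bridge_separating:
  assumes "finite H" "K \<subseteq> H" "bridges H" "(u, v) \<in> conn H" "(u, v) \<notin> conn K"
  obtains a b where "(a, b) \<in> H - K" "(u, v) \<notin> conn (H - {(a, b)})"
proof -
  \<comment> \<open>Adding the arcs of \<open>H - K\<close> one by one, the first one that joins \<open>u\<close> and \<open>v\<close> separates them.\<close>
  have "\<exists>M e. K \<subseteq> M \<and> insert e M \<subseteq> K \<union> N \<and> e \<notin> M \<and> (u, v) \<notin> conn M \<and> (u, v) \<in> conn (insert e M)"
    if "finite N" "(u, v) \<in> conn (K \<union> N)" for N
    using that
  proof (induction N rule: finite_induct)
    case empty
    then show ?case using assms(5) by simp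
  next
    case (insert e N)
    show ?case
    proof (cases "(u, v) \<in> conn (K \<union> N)")
      case True
      with insert.IH show ?thesis by blast
    next
      case False
      then have "e \<notin> K \<union> N" using insert.prems by (metis Un_insert_right insert_absorb)
      with False insert.prems show ?thesis
        by (intro exI[of _ "K \<union> N"] exI[of _ e]) auto
    qed
  qed
  from this[of H] assms obtain M e where M: "K \<subseteq> M" "insert e M \<subseteq> H" "e \<notin> M"
    "(u, v) \<notin> conn M" "(u, v) \<in> conn (insert e M)" by (metis sup.absorb2)
  obtain a b where e: "e = (a, b)" by fastforce
  have sub: "M \<subseteq> H - {(a, b)}" using M e by auto
  \<comment> \<open>The connection in \<open>insert e M\<close> crosses \<open>(a, b)\<close>. A
    second one avoiding that arc would combine with its two ends to a detour around a bridge of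
    \<open>H\<close>.\<close>
  have "(u, v) \<notin> conn (H - {(a, b)})"
  proof
    assume uv: "(u, v) \<in> conn (H - {(a, b)})"
    have "(u, a) \<in> conn M \<and> (b, v) \<in> conn M \<or> (u, b) \<in> conn M \<and> (a, v) \<in> conn M"
      using conn_insert[of u v a b M] M e by blast
    then have "(a, b) \<in> conn (H - {(a, b)})"
      using uv by (meson conn_mono[OF sub] conn_sym conn_trans)
    then show False using assms(3) M e unfolding bridges_def by auto
  qed
  with M e that show ?thesis by blast
qed

text \<open>Removes parent sets as a whole: a proper subset of a potential parent set may lie
  outside the family, whereas the empty set never does.\<close>

definition delete_in :: "'a set \<Rightarrow> ('a \<times> 'a) set \<Rightarrow> ('a \<times> 'a) set" where
  "delete_in Z A = {(a, b) \<in> A. b \<notin> Z}"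

text \<open>Stronger than \<open>G \<subseteq> B\<close>: a node with parents in \<open>G\<close>
  gets no further ones in \<open>B\<close>, so every arc of \<open>B\<close> outside
  \<open>G\<close> enters a node without parents in \<open>G\<close>.\<close>

definition extends :: "('a \<times> 'a) set \<Rightarrow> ('a \<times> 'a) set \<Rightarrow> bool" where
  "extends B G \<longleftrightarrow> (\<forall>v. parents G v \<noteq> {} \<longrightarrow> parents B v = parents G v)"

text \<open>Each new arc closes at most one cycle, and a cycle is broken by dropping the whole parent set
  of one node that \<open>G\<close> has not committed to yet.\<close>

lemma bridges_exchange:
  assumes "finite B" "bridges B" "extends B G" "parents G v = {}"
    and "finite S" "bridges (G \<union> S \<times> {v})"
  obtains Z where "v \<in> Z" "finite Z" "card Z \<le> card S + 1" "\<forall>z \<in> Z. parents G z = {}"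
    "bridges (delete_in Z B \<union> S \<times> {v})"
proof -
  have "\<exists>Z. v \<in> Z \<and> finite Z \<and> card Z \<le> card T + 1 \<and> (\<forall>z \<in> Z. parents G z = {}) \<and>
      bridges (delete_in Z B \<union> T \<times> {v})" if "finite T" "T \<subseteq> S" for T
    using that
  proof (induction T rule: finite_induct)
    \<comment> \<open>Dropping the parent set of \<open>v\<close> itself accounts for the
      \<open>+ 1\<close> in the bound on \<open>card Z\<close>.\<close>
    case empty
    have "bridges (delete_in {v} B)"
      by (rule bridges_mono[OF _ assms(2)]) (auto simp: delete_in_def)
    then show ?case using assms(4) by (intro exI[of _ "{v}"]) auto
  next
    case (insert u T)
    then obtain Z where Z: "v \<in> Z" "finite Z" "card Z \<le> card T + 1" "\<forall>z \<in> Z. parents G z = {}"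
      "bridges (delete_in Z B \<union> T \<times> {v})" by blast
    \<comment> \<open>The arcs in \<open>?K\<close> must survive. As \<open>(u, v)\<close> is a
      bridge of the enlarged greedy graph, \<open>?K\<close> alone does not join \<open>u\<close>
      and \<open>v\<close>, so a separating arc can be found outside \<open>?K\<close>.\<close>
    let ?H = "delete_in Z B \<union> T \<times> {v}" and ?K = "G \<union> T \<times> {v}"
    have GB: "G \<subseteq> delete_in Z B"
      using assms(3) Z(4) unfolding extends_def parents_def delete_in_def by blast
    have "(u, v) \<notin> conn (G \<union> S \<times> {v} - {(u, v)})"
      using assms(6) insert.prems unfolding bridges_def by auto
    moreover have "?K \<subseteq> G \<union> S \<times> {v} - {(u, v)}"
      using insert.hyps(2) insert.prems assms(4) by (auto simp: parents_def)
    ultimately have K: "(u, v) \<notin> conn ?K" using conn_mono[of ?K "G \<union> S \<times> {v} - {(u, v)}"] by auto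
    have ins: "insert u T \<times> {v} = insert (u, v) (T \<times> {v})" by auto
    show ?case
    proof (cases "(u, v) \<in> conn ?H")
      case False
      then have "bridges (delete_in Z B \<union> insert u T \<times> {v})"
        using bridges_insert[OF Z(5)] ins by simp
      then show ?thesis using Z insert.hyps by (intro exI[of _ Z]) auto
    next
      case True
      have "finite ?H" "?K \<subseteq> ?H"
        using assms(1) insert.hyps(1) GB by (auto intro: finite_subset[of _ B] simp: delete_in_def)
      from bridge_separating[OF this Z(5) True K]
      obtain a b where ab: "(a, b) \<in> ?H - ?K" "(u, v) \<notin> conn (?H - {(a, b)})" by blast
      \<comment> \<open>The separating arc is neither in \<open>G\<close> nor in the star, so it
        comes from \<open>B\<close> and its head \<open>b\<close> is still uncommitted.\<close>
      have "(a, b) \<in> B" "b \<notin> Z" "(a, b) \<notin> G" using ab(1) by (auto simp: delete_in_def)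
      then have pb: "parents G b = {}" using assms(3) unfolding extends_def parents_def by blast
      have sub: "delete_in (insert b Z) B \<union> T \<times> {v} \<subseteq> ?H - {(a, b)}"
        using \<open>b \<notin> Z\<close> Z(1) by (auto simp: delete_in_def)
      then have "(u, v) \<notin> conn (delete_in (insert b Z) B \<union> T \<times> {v})"
        using ab(2) conn_mono[OF sub] by auto
      moreover have "bridges (delete_in (insert b Z) B \<union> T \<times> {v})"
        using sub Z(5) by (meson Diff_subset bridges_mono order_trans)
      ultimately have "bridges (delete_in (insert b Z) B \<union> insert u T \<times> {v})"
        using bridges_insert ins by simp
      then show ?thesis
        using Z pb insert.hyps \<open>b \<notin> Z\<close> by (intro exI[of _ "insert b Z"]) auto
    qed
  qed
  from this[OF assms(5) order_refl] that show ?thesis by auto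
qed

section \<open>Component labels\<close>

definition represents :: "('a \<Rightarrow> 'b) \<Rightarrow> ('a \<times> 'a) set \<Rightarrow> bool" where
  "represents f A \<longleftrightarrow> (\<forall>x y. (x, y) \<in> conn A \<longleftrightarrow> f x = f y)"

text \<open>The components met by \<open>S\<close> are merged into that of \<open>v\<close>, so
  their labels are overwritten by the label of \<open>v\<close>; this is the update made by
  \<open>attach\<close>.\<close>

lemma represents_star:
  assumes "represents f A"
  shows "represents (\<lambda>x. if f x \<in> f ` S then f v else f x) (A \<union> S \<times> {v})"
proof -
  let ?g = "\<lambda>x. if f x \<in> f ` S then f v else f x" and ?A = "A \<union> S \<times> {v}"
  have f: "(x, y) \<in> conn A \<longleftrightarrow> f x = f y" for x y
    using assms unfolding represents_def by blast
  have up: "f x = f y \<Longrightarrow> (x, y) \<in> conn ?A" for x y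
    using f conn_mono[of A ?A] by blast
  have v: "(x, v) \<in> conn ?A" if x: "f x \<in> f ` S" for x
  proof -
    obtain s where "s \<in> S" "f x = f s" using x by auto
    then show ?thesis using conn_trans[OF up[of x s] conn_arc[of s v ?A]] by simp
  qed
  have "?g x = ?g y" if "(x, y) \<in> conn ?A" for x y
  proof (rule conn_least[OF that, of ?g])
    fix a b assume "(a, b) \<in> ?A"
    then consider "f a = f b" | "a \<in> S" "b = v" using f[of a b] conn_arc[of a b A] by auto
    then show "?g a = ?g b" by cases auto
  qed
  moreover have "(x, y) \<in> conn ?A" if "?g x = ?g y" for x y
    using that v[of x] v[of y] up[of x y] up[of x v] up[of v y]
    by (auto split: if_splits intro: conn_trans conn_sym)
  ultimately show ?thesis unfolding represents_def by blast
qed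

text \<open>Each further node of \<open>S\<close> has a label different from that of
  \<open>v\<close> and from all those already absorbed, so its arc joins two components and closes
  no cycle.\<close>

lemma bridges_star:
  assumes "represents f A" "bridges A" "finite S" "inj_on f S" "f v \<notin> f ` S"
  shows "bridges (A \<union> S \<times> {v})"
  using assms(3-5)
proof (induction S rule: finite_induct)
  case empty
  then show ?case using assms(2) by simp
next
  case (insert u S)
  let ?g = "\<lambda>x. if f x \<in> f ` S then f v else f x"
  have "f u \<notin> f ` S" "f v \<noteq> f u" using insert by auto
  then have "?g u \<noteq> ?g v" by auto
  then have "(u, v) \<notin> conn (A \<union> S \<times> {v})"
    using represents_star[OF assms(1), of S v] unfolding represents_def by blast
  moreover have "bridges (A \<union> S \<times> {v})" using insert by auto
  moreover have "A \<union> insert u S \<times> {v} = insert (u, v) (A \<union> S \<times> {v})" by auto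
  ultimately show ?case using bridges_insert by metis
qed

text \<open>Two members of \<open>S\<close> in one component, or one in that of \<open>v\<close>,
  would give a detour around a new arc. Since \<open>v\<close> has no parents in \<open>A\<close>,
  removing a new arc leaves \<open>A\<close> intact.\<close>

lemma bridges_starD:
  assumes "represents f A" "bridges (A \<union> S \<times> {v})" "parents A v = {}"
  shows "inj_on f S" "f v \<notin> f ` S"
proof -
  let ?A = "A \<union> S \<times> {v}"
  have bridge: "(u, v) \<notin> conn (?A - {(u, v)})" if "u \<in> S" for u
    using assms(2) that unfolding bridges_def by auto
  have up: "(x, y) \<in> conn (?A - {(u, v)})" if "f x = f y" for x y u
  proof (rule conn_mono[of A])
    show "A \<subseteq> ?A - {(u, v)}" using assms(3) by (auto simp: parents_def)
    show "(x, y) \<in> conn A" using assms(1) that unfolding represents_def by blast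
  qed
  show "inj_on f S"
  proof (rule inj_onI, rule ccontr)
    fix x y assume xy: "x \<in> S" "y \<in> S" "f x = f y" "x \<noteq> y"
    then have "(y, v) \<in> conn (?A - {(x, v)})" by (intro conn_arc) auto
    with up[OF xy(3)] have "(x, v) \<in> conn (?A - {(x, v)})" by (rule conn_trans)
    then show False using bridge xy(1) by blast
  qed
  show "f v \<notin> f ` S" using bridge up by (metis imageE)
qed


section \<open>The greedy algorithm\<close>

type_synonym candidate = "nat \<times> nat list \<times> real"

text \<open>A state consists of the arcs chosen so far and of a list that labels every node with a
  representative of its component.\<close>

type_synonym greedy_state = "(nat \<times> nat) list \<times> (nat \<times> nat) list"

definition candidates :: "listing \<Rightarrow> candidate list" where
  "candidates L = concat (map (\<lambda>n. map (\<lambda>q. (fst n, q)) (snd n)) L)"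

text \<open>A name missing from the list is its own label, so that labels can represent components
  on all of \<open>nat\<close>, where a name outside the node set is a component of its own.\<close>

definition label :: "(nat \<times> nat) list \<Rightarrow> nat \<Rightarrow> nat" where
  "label Q u = snd (foldl (\<lambda>r q. if fst q = u then q else r) (u, u) Q)"

text \<open>If labels represent components and every arc is a bridge, then for a node without
  parents the label conditions hold exactly when the new arcs keep all arcs bridges; see
  \<open>bridges_star\<close> and \<open>bridges_starD\<close>.\<close>

definition feasible :: "greedy_state \<Rightarrow> candidate \<Rightarrow> bool" where
  "feasible st c \<longleftrightarrow> (\<forall>a \<in> set (fst st). snd a \<noteq> fst c) \<and>
     (\<forall>u \<in> set (fst (snd c)). label (snd st) u \<noteq> label (snd st) (fst c) \<and>
        (\<forall>w \<in> set (fst (snd c)). u = w \<or> label (snd st) u \<noteq> label (snd st) w))"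

text \<open>The default value \<open>(0, [], 0)\<close> stands for the absence of a feasible candidate of positive
  score; attaching it changes nothing.\<close>

definition best :: "listing \<Rightarrow> greedy_state \<Rightarrow> candidate" where
  "best L st = foldl (\<lambda>b c. if feasible st c \<and> snd (snd b) < snd (snd c) then c else b)
     (0, [], 0) (candidates L)"

definition attach :: "greedy_state \<Rightarrow> candidate \<Rightarrow> greedy_state" where
  "attach st c = (map (\<lambda>u. (u, fst c)) (fst (snd c)) @ fst st,
     map (\<lambda>q. (fst q, if \<exists>u \<in> set (fst (snd c)). label (snd st) u = snd q
        then label (snd st) (fst c) else snd q)) (snd st))"

definition init_state :: "listing \<Rightarrow> greedy_state" where
  "init_state L = ([], map (\<lambda>n. (fst n, fst n)) L)"

text \<open>Only the length of \<open>xs\<close> matters, as the number of rounds.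
  \<open>greedy\<close> uses \<open>L\<close> itself as the counter, one round per node, which makes
  the loop a fold over the input.\<close>

definition run :: "listing \<Rightarrow> 'a list \<Rightarrow> greedy_state" where
  "run L xs = foldl (\<lambda>st _. attach st (best L st)) (init_state L) xs"

definition greedy :: "listing \<Rightarrow> (nat \<times> nat) list" where
  "greedy L = fst (run L L)"

lemma run_Nil [simp]: "run L [] = init_state L"
  by (simp add: run_def)

lemma run_snoc [simp]: "run L (xs @ [x]) = attach (run L xs) (best L (run L xs))"
  by (simp add: run_def)

lemma foldl_select_in: "foldl (\<lambda>r x. if b r x then x else r) d xs \<in> insert d (set xs)"
  by (induction xs arbitrary: d) auto

text \<open>The default competes without having to satisfy \<open>P\<close>, and comparison is
  strict, so any other result beats it. A default of score 0 thus enforces positive scores.\<close>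

lemma foldl_argmax:
  fixes P :: "'a \<Rightarrow> bool" and f :: "'a \<Rightarrow> 'b :: linorder"
  defines "m \<equiv> \<lambda>d xs. foldl (\<lambda>b c. if P c \<and> f b < f c then c else b) d xs"
  shows "m d xs = d \<or> m d xs \<in> set xs \<and> P (m d xs) \<and> f d < f (m d xs)"
    and "c \<in> set xs \<Longrightarrow> P c \<Longrightarrow> f c \<le> f (m d xs)"
proof (induction xs rule: rev_induct)
  case Nil
  { case 1 show ?case by (simp add: m_def) next case 2 then show ?case by simp }
next
  case (snoc x xs)
  have m: "m d (xs @ [x]) = (if P x \<and> f (m d xs) < f x then x else m d xs)" by (simp add: m_def)
  { case 1 show ?case using snoc.IH(1) unfolding m by auto
  next case 2 then show ?case using snoc.IH(2) unfolding m by fastforce }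
qed

lemma best_in: "best L st \<in> insert (0, [], 0) (set (candidates L))"
  unfolding best_def by (rule foldl_select_in)

lemma label_in: "label Q u \<in> insert u (snd ` set Q)"
  using foldl_select_in[of "\<lambda>_ q. fst q = u" "(u, u)" Q] unfolding label_def by auto

lemma label_eq_map_of:
  "distinct (map fst Q) \<Longrightarrow> label Q u = (case map_of Q u of None \<Rightarrow> u | Some l \<Rightarrow> l)"
proof (induction Q rule: rev_induct)
  case (snoc q Q)
  have "label (Q @ [q]) u = (if fst q = u then snd q else label Q u)" by (simp add: label_def)
  moreover have "map_of Q (fst q) = None" using snoc.prems by (auto simp: map_of_eq_None_iff)
  ultimately show ?case using snoc by (cases q) (auto simp: map_add_def split: option.splits)
qed (simp add: label_def)


section \<open>Running time of the greedy algorithm\<close>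

abbreviation enc_candidate :: "candidate \<Rightarrow> val" where
  "enc_candidate \<equiv> enc_pair enc_nat (enc_pair (enc_list enc_nat) VReal)"

lemma ptime_candidates: "ptime enc_listing (enc_list enc_candidate) candidates"
  unfolding candidates_def[abs_def] enc_listing_def by (rule ptime_intros)+

lemma ptime_label_pair: "ptime (enc_pair enc_arcs enc_nat) enc_nat (\<lambda>z. label (fst z) (snd z))"
  unfolding label_def enc_arcs_def by (rule ptime_select ptime_intros)+

lemmas ptime_label = ptime_comp2[OF ptime_label_pair[unfolded enc_arcs_def]]

lemma ptime_feasible_pair:
  "ptime (enc_pair (enc_pair enc_arcs enc_arcs) enc_candidate) val_bool (\<lambda>z. feasible (fst z) (snd z))"
  unfolding feasible_def enc_arcs_def by (rule ptime_label ptime_intros)+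

lemmas ptime_feasible = ptime_comp2[OF ptime_feasible_pair[unfolded enc_arcs_def]]

lemma ptime_best_pair:
  "ptime (enc_pair enc_listing (enc_pair enc_arcs enc_arcs)) enc_candidate (\<lambda>z. best (fst z) (snd z))"
  unfolding best_def enc_arcs_def
  by (rule ptime_select ptime_feasible ptime_comp[OF _ ptime_candidates] ptime_intros)+

lemma ptime_attach_pair:
  "ptime (enc_pair (enc_pair enc_arcs enc_arcs) enc_candidate) (enc_pair enc_arcs enc_arcs)
    (\<lambda>z. attach (fst z) (snd z))"
  unfolding attach_def enc_arcs_def by (rule ptime_label ptime_intros)+

lemma ptime_init_state: "ptime enc_listing (enc_pair enc_arcs enc_arcs) init_state"
  unfolding init_state_def[abs_def] enc_arcs_def enc_listing_def by (rule ptime_intros)+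

text \<open>\<open>ptime\<close> asks for bounds on every listing, valid or not, so they rest on
  syntax alone: names in the state are copied from the input or are \<open>0\<close>, and a round
  adds at most one parent list of the input.\<close>

lemma run_bounds:
  fixes L :: listing and xs :: "'a list"
  defines "N \<equiv> val_size (enc_listing L)"
  shows "\<forall>a \<in> set (fst (run L xs)). val_size (enc_nat (fst a)) \<le> N \<and> val_size (enc_nat (snd a)) \<le> N"
    and "length (fst (run L xs)) \<le> length xs * N"
    and "length (snd (run L xs)) = length L"
    and "\<forall>q \<in> set (snd (run L xs)). val_size (enc_nat (fst q)) \<le> N \<and> val_size (enc_nat (snd q)) \<le> N"
proof -
  have N: "1 \<le> N" unfolding N_def by (rule val_size_pos)
  have node: "val_size (enc_nat v) + val_size (enc_list (enc_pair (enc_list enc_nat) VReal) ps) \<le> N"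
    if "(v, ps) \<in> set L" for v ps
    using val_size_elem[OF that, of "enc_pair enc_nat (enc_list (enc_pair (enc_list enc_nat) VReal))"]
    unfolding N_def enc_listing_def by (simp add: enc_pair_def)
  have cand: "val_size (enc_nat (fst c)) \<le> N \<and> val_size (enc_list enc_nat (fst (snd c))) \<le> N"
    if "c \<in> insert (0, [], 0) (set (candidates L))" for c
  proof (cases "c = (0, [], 0)")
    case True
    then show ?thesis using N by (simp add: enc_nat.simps enc_list_def)
  next
    case False
    then have "c \<in> set (candidates L)" using that by simp
    then obtain v ps q where *: "(v, ps) \<in> set L" "q \<in> set ps" "c = (v, q)"
      unfolding candidates_def by auto
    have "val_size (enc_list enc_nat (fst q)) \<le> val_size (enc_list (enc_pair (enc_list enc_nat) VReal) ps)"
      using val_size_elem[OF *(2), of "enc_pair (enc_list enc_nat) VReal"] by (simp add: enc_pair_def)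
    then show ?thesis using node[OF *(1)] *(3) by auto
  qed
  have "(\<forall>a \<in> set (fst (run L xs)). val_size (enc_nat (fst a)) \<le> N \<and> val_size (enc_nat (snd a)) \<le> N) \<and>
    length (fst (run L xs)) \<le> length xs * N \<and> length (snd (run L xs)) = length L \<and>
    (\<forall>q \<in> set (snd (run L xs)). val_size (enc_nat (fst q)) \<le> N \<and> val_size (enc_nat (snd q)) \<le> N)"
  proof (induction xs rule: rev_induct)
    case Nil
    show ?case using node by (fastforce simp: init_state_def)
  next
    case (snoc x xs)
    let ?st = "run L xs"
    define c where "c = best L ?st"
    have c: "val_size (enc_nat (fst c)) \<le> N" "val_size (enc_list enc_nat (fst (snd c))) \<le> N"
      using cand[OF best_in[of L ?st]] by (auto simp: c_def)
    have u: "val_size (enc_nat u) \<le> N" if "u \<in> set (fst (snd c))" for u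
      using val_size_elem[OF that, of enc_nat] c(2) by linarith
    have len: "length (fst (snd c)) \<le> N"
      using length_less_val_size[of "fst (snd c)" enc_nat] c(2) by linarith
    have "label (snd ?st) (fst c) = fst c \<or> label (snd ?st) (fst c) \<in> snd ` set (snd ?st)"
      using label_in[of "snd ?st" "fst c"] by blast
    then have "val_size (enc_nat (label (snd ?st) (fst c))) \<le> N" using c(1) snoc.IH by auto
    then show ?case using snoc.IH c(1) u len by (auto simp: attach_def c_def[symmetric])
  qed
  then show "\<forall>a \<in> set (fst (run L xs)). val_size (enc_nat (fst a)) \<le> N \<and> val_size (enc_nat (snd a)) \<le> N"
    "length (fst (run L xs)) \<le> length xs * N"
    "length (snd (run L xs)) = length L"
    "\<forall>q \<in> set (snd (run L xs)). val_size (enc_nat (fst q)) \<le> N \<and> val_size (enc_nat (snd q)) \<le> N"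
    by blast+
qed

text \<open>A list cell with a pair of names has size at most \<open>2 + 2 * N\<close>. There are at
  most \<open>N * N\<close> arcs and \<open>N\<close> labels; the \<open>3\<close> counts the outer
  pair and two list ends.\<close>

lemma val_size_run:
  fixes L :: listing
  defines "N \<equiv> val_size (enc_listing L)"
  assumes "length xs \<le> length L"
  shows "val_size (enc_pair enc_arcs enc_arcs (run L xs)) \<le> 3 + N * N * (2 + 2 * N) + N * (2 + 2 * N)"
proof -
  note b = run_bounds[where L = L and xs = xs, folded N_def]
  have L: "length L \<le> N"
    using length_less_val_size[of L] unfolding N_def enc_listing_def by (meson less_imp_le)
  have "val_size (enc_arcs (fst (run L xs))) \<le> 1 + length (fst (run L xs)) * (1 + (1 + 2 * N))"
    unfolding enc_arcs_def by (rule val_size_enc_list_le) (use b(1) in \<open>fastforce simp: enc_pair_def\<close>)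
  also have "\<dots> \<le> 1 + N * N * (2 + 2 * N)"
  proof -
    have "length xs * N \<le> N * N" using assms(2) L by (intro mult_right_mono) auto
    then have "length (fst (run L xs)) \<le> N * N" using b(2) by linarith
    then have "length (fst (run L xs)) * (2 + 2 * N) \<le> N * N * (2 + 2 * N)" by (rule mult_le_mono1)
    then show ?thesis by simp
  qed
  finally have 1: "val_size (enc_arcs (fst (run L xs))) \<le> 1 + N * N * (2 + 2 * N)" .
  have "val_size (enc_arcs (snd (run L xs))) \<le> 1 + length (snd (run L xs)) * (1 + (1 + 2 * N))"
    unfolding enc_arcs_def by (rule val_size_enc_list_le) (use b(4) in \<open>fastforce simp: enc_pair_def\<close>)
  also have "\<dots> \<le> 1 + N * (2 + 2 * N)"
    using mult_le_mono1[OF L, of "2 + 2 * N"] b(3) by simp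
  finally show ?thesis using 1 by (simp add: enc_pair_def)
qed

lemma ptime_greedy: "ptime enc_listing enc_arcs greedy"
proof -
  let ?e = "enc_pair enc_arcs enc_arcs"
  have "ptime enc_listing ?e (\<lambda>L. foldl (\<lambda>st _. attach st (best L st)) (init_state L) L)"
  proof (rule ptime_foldl[where h = "\<lambda>L st _. attach st (best L st)"
        and ex = "enc_pair enc_nat (enc_list (enc_pair (enc_list enc_nat) VReal))"
        and q = "[:3:] + [:0, 1:] * [:0, 1:] * [:2, 2:] + [:0, 1:] * [:2, 2:]"])
    show "ptime (enc_pair (enc_pair enc_listing ?e)
        (enc_pair enc_nat (enc_list (enc_pair (enc_list enc_nat) VReal)))) ?e
      (\<lambda>z. attach (snd (fst z)) (best (fst (fst z)) (snd (fst z))))"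
      by (rule ptime_comp2[OF ptime_attach_pair] ptime_comp2[OF ptime_best_pair] ptime_intros)+
    show "ptime enc_listing ?e init_state" by (rule ptime_init_state)
    show "ptime enc_listing (enc_list (enc_pair enc_nat (enc_list (enc_pair (enc_list enc_nat) VReal)))) (\<lambda>L. L)"
      unfolding enc_listing_def by (rule ptime_id)
    fix L ys zs :: listing assume "L = ys @ zs"
    then have "length ys \<le> length L" by simp
    from val_size_run[OF this]
    show "val_size (?e (foldl (\<lambda>st _. attach st (best L st)) (init_state L) ys))
      \<le> poly ([:3:] + [:0, 1:] * [:0, 1:] * [:2, 2:] + [:0, 1:] * [:2, 2:]) (val_size (enc_listing L))"
      by (simp add: run_def algebra_simps)
  qed
  from ptime_fst[OF this] show ?thesis unfolding greedy_def[abs_def] run_def .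
qed


section \<open>Approximation guarantee\<close>

lemma parents_star:
  "parents (A \<union> S \<times> {v}) y = (if y = v then parents A v \<union> S else parents A y)"
  by (auto simp: parents_def)

lemma parents_delete_in: "parents (delete_in Z A) y = (if y \<in> Z then {} else parents A y)"
  by (auto simp: parents_def delete_in_def)

lemma feasible_iff:
  "feasible st (v, S, r) \<longleftrightarrow> parents (set (fst st)) v = {} \<and> inj_on (label (snd st)) (set S) \<and>
    label (snd st) v \<notin> label (snd st) ` set S"
proof -
  have "(\<forall>a \<in> set (fst st). snd a \<noteq> v) \<longleftrightarrow> parents (set (fst st)) v = {}"
    by (auto simp: parents_def)
  then show ?thesis unfolding feasible_def inj_on_def image_iff by auto
qed

locale listed_instance =
  fixes k :: nat and I :: pt_instance and L :: listing
  assumes valid: "valid_instance k I" and listed: "lists_instance L I"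
begin

abbreviation "V \<equiv> nodes I"

definition weight :: "nat \<Rightarrow> nat set \<Rightarrow> real" where
  "weight v S = real_of_ereal (local_score I v S)"

text \<open>Requiring every parent set to lie in its family makes all local scores finite, so that
  they equal their \<open>weight\<close>.\<close>

definition admissible :: "(nat \<times> nat) set \<Rightarrow> bool" where
  "admissible A \<longleftrightarrow> A \<subseteq> V \<times> V \<and> bridges A \<and> (\<forall>v \<in> V. parents A v \<in> families I v)"

definition total_weight :: "(nat \<times> nat) set \<Rightarrow> real" where
  "total_weight A = (\<Sum>v \<in> V. weight v (parents A v))"

lemma finite_nodes: "finite V"
  using valid by (simp add: valid_instance_def)

lemma family_nodes: "v \<in> V \<Longrightarrow> S \<in> families I v \<Longrightarrow> S \<subseteq> V"
  using valid unfolding valid_instance_def by blast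

lemma family_card: "v \<in> V \<Longrightarrow> S \<in> families I v \<Longrightarrow> card S \<le> k"
  using valid unfolding valid_instance_def by blast

lemma empty_in_family: "v \<in> V \<Longrightarrow> {} \<in> families I v"
  using valid unfolding valid_instance_def by blast

lemma local_score_weight: "v \<in> V \<Longrightarrow> S \<in> families I v \<Longrightarrow> local_score I v S = ereal (weight v S)"
  using valid unfolding valid_instance_def weight_def by (simp add: ereal_real)

lemma weight_empty: "v \<in> V \<Longrightarrow> weight v {} = 0"
  using valid unfolding valid_instance_def weight_def by simp

lemma score_admissible: "admissible A \<Longrightarrow> score I A = ereal (total_weight A)"
  unfolding score_def total_weight_def admissible_def sum_ereal[symmetric]
  by (intro sum.cong) (auto simp: local_score_weight)

lemma candidatesD:
  assumes "(v, S, r) \<in> set (candidates L)"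
  shows "v \<in> V" "set S \<in> families I v" "distinct S" "weight v (set S) = r"
proof -
  obtain ps where ps: "(v, ps) \<in> set L" "(S, r) \<in> set ps"
    using assms by (auto simp: candidates_def)
  show v: "v \<in> V" using ps(1) listed unfolding lists_instance_def by force
  have "lists_family ps (families I v) (local_score I v)"
    using ps(1) listed unfolding lists_instance_def by blast
  then have fam: "set ` fst ` set ps = families I v"
    "\<forall>(S, r) \<in> set ps. distinct S \<and> local_score I v (set S) = ereal r"
    by (simp_all add: lists_family_def)
  show "set S \<in> families I v" using fam(1) imageI[OF imageI[OF ps(2), of fst], of set] by simp
  show "distinct S" "weight v (set S) = r" using bspec[OF fam(2) ps(2)] by (simp_all add: weight_def)
qed

lemma candidatesI:
  assumes "v \<in> V" "T \<in> families I v"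
  obtains S where "(v, S, weight v T) \<in> set (candidates L)" "set S = T"
proof -
  have "v \<in> fst ` set L" using assms(1) listed unfolding lists_instance_def by blast
  then obtain ps where ps: "(v, ps) \<in> set L" by force
  then have fam: "lists_family ps (families I v) (local_score I v)"
    using listed unfolding lists_instance_def by blast
  then have "T \<in> set ` fst ` set ps" using assms(2) unfolding lists_family_def by blast
  then obtain S r where S: "(S, r) \<in> set ps" "set S = T" by force
  then have "weight v T = r" using fam unfolding lists_family_def weight_def by force
  with S ps have "(v, S, weight v T) \<in> set (candidates L)" by (force simp: candidates_def)
  with S(2) that show ?thesis by blast
qed

section \<open>Invariants of a greedy run\<close>

definition well_labelled :: "greedy_state \<Rightarrow> bool" where
  "well_labelled st \<longleftrightarrow> map fst (snd st) = map fst L \<and> snd ` set (snd st) \<subseteq> V \<and>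
     represents (label (snd st)) (set (fst st)) \<and> distinct (fst st) \<and> admissible (set (fst st))"

text \<open>Labels of nodes are nodes and outsiders label themselves. The last claim keeps the two
  kinds apart when components are merged.\<close>

lemma label_well_labelled:
  assumes "well_labelled st"
  shows "label (snd st) u = (case map_of (snd st) u of None \<Rightarrow> u | Some l \<Rightarrow> l)"
    and "u \<in> V \<longleftrightarrow> map_of (snd st) u \<noteq> None" and "u \<in> V \<longleftrightarrow> label (snd st) u \<in> V"
proof -
  have fst: "map fst (snd st) = map fst L" and lab: "snd ` set (snd st) \<subseteq> V"
    using assms unfolding well_labelled_def by blast+
  have "distinct (map fst (snd st))" using fst listed unfolding lists_instance_def by simp
  then show eq: "label (snd st) u = (case map_of (snd st) u of None \<Rightarrow> u | Some l \<Rightarrow> l)"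
    by (rule label_eq_map_of)
  have "fst ` set (snd st) = V"
    using arg_cong[OF fst, of set] listed unfolding lists_instance_def by simp
  then show V: "u \<in> V \<longleftrightarrow> map_of (snd st) u \<noteq> None" by (simp add: map_of_eq_None_iff)
  show "u \<in> V \<longleftrightarrow> label (snd st) u \<in> V"
    using eq V lab by (force split: option.splits dest: map_of_SomeD)
qed

text \<open>The greedy arcs and this parent set lie together in \<open>B\<close>, where every arc is
  a bridge, so no cycle is closed. This makes dropped parent sets comparable with the greedy
  choice.\<close>

lemma feasible_of_extension:
  assumes "well_labelled st" "bridges B" "extends B (set (fst st))" "parents (set (fst st)) v = {}"
    "parents B v = set S"
  shows "feasible st (v, S, r)"
proof -
  let ?G = "set (fst st)"
  have "?G \<union> set S \<times> {v} \<subseteq> B"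
  proof -
    have "u \<in> parents B w" if "u \<in> parents ?G w" for u w
      using that assms(3) unfolding extends_def by auto
    then show ?thesis using assms(5) by (auto simp: parents_def)
  qed
  then have "bridges (?G \<union> set S \<times> {v})" using assms(2) bridges_mono by blast
  moreover have "represents (label (snd st)) ?G" using assms(1) by (simp add: well_labelled_def)
  ultimately show ?thesis
    using assms(4) bridges_starD[of "label (snd st)" ?G "set S" v] feasible_iff by blast
qed

lemma well_labelled_init: "well_labelled (init_state L)"
proof -
  have 1: "map fst (snd (init_state L)) = map fst L" "snd ` set (snd (init_state L)) \<subseteq> V"
    using listed by (simp_all add: init_state_def lists_instance_def image_image comp_def)
  have "distinct (map fst (snd (init_state L)))"
    using listed unfolding 1(1) by (simp add: lists_instance_def)
  then have "label (snd (init_state L)) u = (case map_of (snd (init_state L)) u of None \<Rightarrow> u | Some l \<Rightarrow> l)" for u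
    by (rule label_eq_map_of)
  then have "label (snd (init_state L)) u = u" for u
    by (auto simp: init_state_def split: option.splits dest!: map_of_SomeD)
  then have "represents (label (snd (init_state L))) {}"
    by (simp add: represents_def conn_def)
  moreover have "admissible {}"
    by (simp add: admissible_def bridges_def parents_def empty_in_family)
  ultimately show ?thesis using 1 by (simp add: well_labelled_def init_state_def)
qed

lemma well_labelled_attach:
  assumes st: "well_labelled st" and c: "(v, S, r) \<in> set (candidates L)" "feasible st (v, S, r)"
  shows "well_labelled (attach st (v, S, r))"
    and "set (fst (attach st (v, S, r))) = set (fst st) \<union> set S \<times> {v}"
proof -
  let ?G = "set (fst st)" and ?f = "label (snd st)" and ?st = "attach st (v, S, r)"
  note cand = candidatesD[OF c(1)]
  have feas: "parents ?G v = {}" "inj_on ?f (set S)" "?f v \<notin> ?f ` set S"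
    using c(2) feasible_iff by auto
  have rep: "represents ?f ?G" and dist: "distinct (fst st)" and adm: "admissible ?G"
    and fsts: "map fst (snd st) = map fst L" and lab: "snd ` set (snd st) \<subseteq> V"
    using st unfolding well_labelled_def by blast+
  define g where "g l = (if l \<in> ?f ` set S then ?f v else l)" for l
  have snd: "snd ?st = map (\<lambda>(w, l). (w, g l)) (snd st)"
    by (auto simp: attach_def g_def)
  show set: "set (fst ?st) = ?G \<union> set S \<times> {v}" by (auto simp: attach_def)
  have "bridges (?G \<union> set S \<times> {v})"
    using bridges_star[OF rep _ _ feas(2,3)] adm by (simp add: admissible_def)
  moreover have "\<forall>y \<in> V. parents (?G \<union> set S \<times> {v}) y \<in> families I y"
    using adm cand(2) feas(1) by (auto simp: parents_star admissible_def)
  moreover have "?G \<union> set S \<times> {v} \<subseteq> V \<times> V"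
    using adm cand(1) family_nodes[OF cand(1,2)] by (auto simp: admissible_def)
  ultimately have adm': "admissible (?G \<union> set S \<times> {v})" by (simp add: admissible_def)
  have fsts': "map fst (snd ?st) = map fst L" using fsts by (simp add: attach_def comp_def)
  have lab': "snd ` set (snd ?st) \<subseteq> V"
    using lab label_well_labelled(3)[OF st, of v] cand(1) unfolding snd by (auto simp: g_def)
  have "distinct (map fst (snd ?st))" using fsts' listed by (simp add: lists_instance_def)
  then have "label (snd ?st) u = (case map_of (snd ?st) u of None \<Rightarrow> u | Some l \<Rightarrow> l)" for u
    by (rule label_eq_map_of)
  \<comment> \<open>\<open>attach\<close> rewrites listed labels only, which is enough because an
    unlisted name never shares a label with a member of \<open>S\<close>.\<close>
  moreover have "?f u \<notin> ?f ` set S" if "u \<notin> V" for u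
    using that label_well_labelled(3)[OF st] family_nodes[OF cand(1,2)] by (metis imageE subsetD)
  ultimately have "label (snd ?st) u = g (?f u)" for u
    using label_well_labelled(1,2)[OF st, of u] unfolding snd
    by (cases "map_of (snd st) u") (auto simp: map_of_map g_def)
  then have "label (snd ?st) = (\<lambda>u. if ?f u \<in> ?f ` set S then ?f v else ?f u)"
    by (auto simp: g_def)
  then have rep': "represents (label (snd ?st)) (?G \<union> set S \<times> {v})"
    using represents_star[OF rep] by simp
  have "distinct (fst ?st)"
    using dist cand(3) feas(1) by (auto simp: attach_def distinct_map inj_on_def parents_def)
  with set adm' fsts' lab' rep' show "well_labelled ?st" by (simp add: well_labelled_def)
qed

definition stuck :: "greedy_state \<Rightarrow> bool" where
  "stuck st \<longleftrightarrow> (\<forall>(v, S, r) \<in> set (candidates L). feasible st (v, S, r) \<longrightarrow> r \<le> 0)"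

text \<open>In a stuck state the default is attached and the state repeats, so surplus rounds do no
  harm.\<close>

lemma best_cases:
  obtains (stuck) "stuck st" "attach st (best L st) = st"
  | (pick) v S r where "best L st = (v, S, r)" "(v, S, r) \<in> set (candidates L)" "feasible st (v, S, r)"
    "0 < r" "\<forall>(v', S', r') \<in> set (candidates L). feasible st (v', S', r') \<longrightarrow> r' \<le> r"
proof -
  have 1: "best L st = (0, [], 0) \<or>
      best L st \<in> set (candidates L) \<and> feasible st (best L st) \<and> 0 < snd (snd (best L st))"
    using foldl_argmax(1)[of "feasible st" "\<lambda>c. snd (snd c)" "(0, [], 0)" "candidates L"]
    unfolding best_def by simp
  have 2: "snd (snd c) \<le> snd (snd (best L st))" if "c \<in> set (candidates L)" "feasible st c" for c
    using foldl_argmax(2)[of c "candidates L" "feasible st" "\<lambda>c. snd (snd c)" "(0, [], 0)"] that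
    unfolding best_def by simp
  show ?thesis
  proof (cases "best L st = (0, [], 0)")
    case True
    then have "stuck st" using 2 by (fastforce simp: stuck_def)
    moreover have "attach st (best L st) = st" using True by (simp add: attach_def)
    ultimately show ?thesis by (rule stuck)
  next
    case False
    obtain v S r where b: "best L st = (v, S, r)" by (metis prod_cases3)
    show ?thesis by (rule pick[OF b]) (use 1 2 False b in fastforce)+
  qed
qed

section \<open>Charging the losses of the completion to the greedy gains\<close>

definition free :: "(nat \<times> nat) set \<Rightarrow> nat set" where
  "free G = {v \<in> V. parents G v = {}}"

text \<open>The completion \<open>B\<close> of the greedy arcs \<open>G\<close> starts as the optimum. A greedy step costs it at
  most \<open>k + 1\<close> parent sets, each of which was a feasible choice for that step.\<close>

definition competitive :: "real \<Rightarrow> (nat \<times> nat) set \<Rightarrow> bool" where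
  "competitive w G \<longleftrightarrow> (\<exists>B. admissible B \<and> extends B G \<and>
     w \<le> real (k + 1) * total_weight G + (\<Sum>v \<in> free G. weight v (parents B v)))"

lemma competitive_step:
  assumes st: "well_labelled st" and comp: "competitive w (set (fst st))"
    and c: "(v, S, r) \<in> set (candidates L)" "feasible st (v, S, r)" "0 < r"
    and max: "\<forall>(v', S', r') \<in> set (candidates L). feasible st (v', S', r') \<longrightarrow> r' \<le> r"
  shows "competitive w (set (fst st) \<union> set S \<times> {v})"
    and "free (set (fst st) \<union> set S \<times> {v}) = free (set (fst st)) - {v}" and "v \<in> free (set (fst st))"
proof -
  let ?G = "set (fst st)"
  let ?G' = "?G \<union> set S \<times> {v}"
  note cand = candidatesD[OF c(1)]
  have pv: "parents ?G v = {}" using c(2) feasible_iff by auto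
  \<comment> \<open>A positive score excludes the empty parent set, so the step really uses up
    \<open>v\<close>.\<close>
  have S: "set S \<noteq> {}" using cand(4) c(3) weight_empty[OF cand(1)] by auto
  show vfree: "v \<in> free ?G" using pv cand(1) by (simp add: free_def)
  show free': "free ?G' = free ?G - {v}"
    using S by (auto simp: free_def parents_star)
  obtain B where B: "admissible B" "extends B ?G"
    "w \<le> real (k + 1) * total_weight ?G + (\<Sum>v \<in> free ?G. weight v (parents B v))"
    using comp unfolding competitive_def by blast
  have finB: "finite B"
    using B(1) finite_nodes finite_subset[of B "V \<times> V"] by (simp add: admissible_def)
  have brB: "bridges B" using B(1) by (simp add: admissible_def)
  have "bridges ?G'"
    using well_labelled_attach[OF st c(1,2)] by (simp add: well_labelled_def admissible_def)
  from bridges_exchange[OF finB brB B(2) pv _ this]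
  obtain Z where Z: "v \<in> Z" "finite Z" "card Z \<le> card (set S) + 1" "\<forall>z \<in> Z. parents ?G z = {}"
    "bridges (delete_in Z B \<union> set S \<times> {v})" by auto
  let ?B = "delete_in Z B \<union> set S \<times> {v}"
  have pB: "parents ?B y = (if y = v then set S else if y \<in> Z then {} else parents B y)" for y
    using Z(1) by (auto simp: parents_star parents_delete_in)
  have "admissible ?B"
    unfolding admissible_def
  proof (intro conjI ballI Z(5))
    show "?B \<subseteq> V \<times> V"
      using B(1) cand(1) family_nodes[OF cand(1,2)] by (auto simp: admissible_def delete_in_def)
    show "parents ?B y \<in> families I y" if "y \<in> V" for y
      using that B(1) cand(2) empty_in_family by (auto simp: pB admissible_def)
  qed
  moreover have "extends ?B ?G'"
    using B(2) Z(4) pv unfolding extends_def pB parents_star[of ?G] by auto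
  moreover have "w \<le> real (k + 1) * total_weight ?G' + (\<Sum>y \<in> free ?G'. weight y (parents ?B y))"
  proof -
    have finF: "finite (free ?G)" using finite_nodes by (simp add: free_def)
    have "total_weight ?G' = (\<Sum>y \<in> V. weight y (parents ?G y) + (if y = v then r else 0))"
      unfolding total_weight_def using cand(4) pv weight_empty[OF cand(1)]
      by (intro sum.cong) (auto simp: parents_star)
    then have tot: "total_weight ?G' = total_weight ?G + r"
      using finite_nodes cand(1) by (simp add: sum.distrib total_weight_def)
    \<comment> \<open>Free nodes in \<open>Z\<close> other than \<open>v\<close> now contribute 0
      and \<open>v\<close> has left the sum, so only free nodes outside \<open>Z\<close>
      remain.\<close>
    have "(\<Sum>y \<in> free ?G'. weight y (parents ?B y)) = (\<Sum>y \<in> free ?G - Z. weight y (parents B y))"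
    proof (rule sum.mono_neutral_cong_right)
      show "finite (free ?G')" using finF free' by simp
      show "free ?G - Z \<subseteq> free ?G'" using free' Z(1) by auto
      show "\<forall>y \<in> free ?G' - (free ?G - Z). weight y (parents ?B y) = 0"
        using free' weight_empty by (auto simp: pB free_def)
      show "weight y (parents ?B y) = weight y (parents B y)" if "y \<in> free ?G - Z" for y
        using that Z(1) by (auto simp: pB)
    qed
    moreover have "(\<Sum>y \<in> free ?G. weight y (parents B y)) =
        (\<Sum>y \<in> free ?G - Z. weight y (parents B y)) + (\<Sum>y \<in> free ?G \<inter> Z. weight y (parents B y))"
      using sum.Int_Diff[OF finF, of "\<lambda>y. weight y (parents B y)" Z] by simp
    \<comment> \<open>At most \<open>k + 1\<close> sets are lost, each of score at most
      \<open>r\<close> by the greedy choice; \<open>0 < r\<close> allows their number to be rounded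
      up.\<close>
    moreover have "(\<Sum>y \<in> free ?G \<inter> Z. weight y (parents B y)) \<le> real (k + 1) * r"
    proof -
      have "weight y (parents B y) \<le> r" if "y \<in> free ?G \<inter> Z" for y
      proof -
        have y: "y \<in> V" "parents ?G y = {}" using that by (auto simp: free_def)
        then have "parents B y \<in> families I y" using B(1) by (simp add: admissible_def)
        from candidatesI[OF y(1) this] obtain T where
          T: "(y, T, weight y (parents B y)) \<in> set (candidates L)" "set T = parents B y" .
        then have "feasible st (y, T, weight y (parents B y))"
          using feasible_of_extension[OF st brB B(2) y(2)] by metis
        then show ?thesis using max T(1) by blast
      qed
      then have "(\<Sum>y \<in> free ?G \<inter> Z. weight y (parents B y)) \<le> real (card (free ?G \<inter> Z)) * r"
        by (rule sum_bounded_above)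
      also have "\<dots> \<le> real (k + 1) * r"
      proof (rule mult_right_mono)
        have "card (free ?G \<inter> Z) \<le> card Z" using Z(2) by (simp add: card_mono)
        then show "real (card (free ?G \<inter> Z)) \<le> real (k + 1)"
          using Z(3) family_card[OF cand(1,2)] by linarith
      qed (use c(3) in simp)
      finally show ?thesis .
    qed
    ultimately show ?thesis using B(3) unfolding tot by (simp add: algebra_simps)
  qed
  ultimately show "competitive w ?G'" unfolding competitive_def by blast
qed

text \<open>The last clause counts rounds: unless greedy is stuck, every round so far has used up a
  free node, so after \<open>card V\<close> rounds it is stuck or no node is free.\<close>

lemma run_invariant:
  assumes "admissible B"
  shows "well_labelled (run L xs) \<and> competitive (total_weight B) (set (fst (run L xs))) \<and>
    (stuck (run L xs) \<or> card (free (set (fst (run L xs)))) + length xs \<le> card V)"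
proof (induction xs rule: rev_induct)
  case Nil
  have "free {} = V" by (auto simp: free_def parents_def)
  moreover have "total_weight {} = 0" by (simp add: total_weight_def parents_def weight_empty)
  ultimately have "competitive (total_weight B) {}"
    using assms unfolding competitive_def extends_def
    by (intro exI[of _ B]) (simp add: parents_def total_weight_def)
  then show ?case using \<open>free {} = V\<close> well_labelled_init by (simp add: init_state_def)
next
  case (snoc x xs)
  let ?st = "run L xs"
  have IH: "well_labelled ?st" "competitive (total_weight B) (set (fst ?st))"
    "stuck ?st \<or> card (free (set (fst ?st))) + length xs \<le> card V"
    using snoc by blast+
  show ?case
  proof (cases ?st rule: best_cases)
    case stuck
    then show ?thesis using IH by simp
  next
    case (pick v S r)
    note step = competitive_step[OF IH(1,2) pick(2-5)]
    note wl = well_labelled_attach[OF IH(1) pick(2,3)]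
    have "\<not> stuck ?st" using pick(2-4) unfolding stuck_def by force
    then have "card (free (set (fst ?st))) + length xs \<le> card V" using IH(3) by blast
    moreover have "card (free (set (fst ?st)) - {v}) < card (free (set (fst ?st)))"
      using step(3) finite_nodes by (intro card_Diff1_less) (auto simp: free_def)
    ultimately have "card (free (set (fst ?st)) - {v}) + length (xs @ [x]) \<le> card V" by simp
    then show ?thesis using wl(1) step(1) unfolding run_snoc pick(1) wl(2) step(2) by blast
  qed
qed

lemma greedy_correct:
  shows "distinct (greedy L)" "admissible (set (greedy L))"
    and "admissible B \<Longrightarrow> total_weight B \<le> real (k + 1) * total_weight (set (greedy L))"
proof -
  let ?st = "run L L" and ?G = "set (greedy L)"
  have "admissible {}" using well_labelled_init by (simp add: well_labelled_def init_state_def)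
  from run_invariant[OF this, of L] have st: "well_labelled ?st" and
    fin: "stuck ?st \<or> card (free ?G) + length L \<le> card V" by (auto simp: greedy_def)
  show "distinct (greedy L)" "admissible ?G"
    using st by (simp_all add: well_labelled_def greedy_def)
  have "length L = card V"
    using listed distinct_card[of "map fst L"] by (simp add: lists_instance_def)
  then have "stuck ?st \<or> free ?G = {}"
    using fin finite_nodes by (auto simp: free_def)
  assume "admissible B"
  from run_invariant[OF this, of L] obtain C where C: "admissible C" "extends C ?G"
    "total_weight B \<le> real (k + 1) * total_weight ?G + (\<Sum>v \<in> free ?G. weight v (parents C v))"
    unfolding competitive_def greedy_def by blast
  \<comment> \<open>A free node exists at the end only if greedy is stuck, and there the parent set
    left in the completion is feasible, hence not of positive score.\<close>
  have "weight v (parents C v) \<le> 0" if v: "v \<in> free ?G" for v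
  proof -
    have vV: "v \<in> V" "parents ?G v = {}" using v by (auto simp: free_def)
    then have "parents C v \<in> families I v" using C(1) by (simp add: admissible_def)
    from candidatesI[OF vV(1) this] obtain T where
      T: "(v, T, weight v (parents C v)) \<in> set (candidates L)" "set T = parents C v" .
    have "bridges C" using C(1) by (simp add: admissible_def)
    then have "feasible ?st (v, T, weight v (parents C v))"
      using feasible_of_extension[OF st, of C v T] C(2) vV(2) T(2) by (simp add: greedy_def)
    then show ?thesis using T(1) v \<open>stuck ?st \<or> free ?G = {}\<close> unfolding stuck_def by blast
  qed
  then have "(\<Sum>v \<in> free ?G. weight v (parents C v)) \<le> 0" by (rule sum_nonpos)
  then show "total_weight B \<le> real (k + 1) * total_weight ?G" using C(3) by linarith
qed

lemma polytree_admissible: "admissible A \<Longrightarrow> polytree V A"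
  using polytree_iff_bridges[OF finite_nodes] by (simp add: admissible_def)

text \<open>The empty graph scores 0. As no local score is \<open>\<infinity>\<close>, a single
  \<open>- \<infinity>\<close> would pull the whole sum below that.\<close>

lemma max_score_polytree_admissible:
  assumes "max_score_polytree I A"
  shows "admissible A"
proof -
  have A: "A \<subseteq> V \<times> V" "bridges A"
    using assms polytree_iff_bridges[OF finite_nodes] by (auto simp: max_score_polytree_def)
  have adm: "admissible {}" using well_labelled_init by (simp add: well_labelled_def init_state_def)
  have "total_weight {} = 0" by (simp add: total_weight_def parents_def weight_empty)
  then have "score I {} = 0" using score_admissible[OF adm] by simp
  then have "0 \<le> score I A"
    using assms polytree_admissible[OF adm] unfolding max_score_polytree_def by metis
  have "parents A v \<in> families I v" if v: "v \<in> V" for v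
  proof (rule ccontr)
    assume "parents A v \<notin> families I v"
    then have "local_score I v (parents A v) = - \<infinity>" using v valid by (auto simp: valid_instance_def)
    moreover have "local_score I u S \<noteq> \<infinity>" if "u \<in> V" for u S
      using that valid unfolding valid_instance_def
      by (metis MInfty_neq_PInfty(1) abs_ereal.simps(3))
    then have "(\<Sum>u \<in> V - {v}. local_score I u (parents A u)) \<noteq> \<infinity>"
      by (auto simp: sum_Pinfty)
    ultimately have "score I A = - \<infinity>"
      unfolding score_def using sum.remove[OF finite_nodes v, of "\<lambda>u. local_score I u (parents A u)"]
      by (cases "\<Sum>u \<in> V - {v}. local_score I u (parents A u)") auto
    then show False using \<open>0 \<le> score I A\<close> by simp
  qed
  with A show ?thesis by (simp add: admissible_def)
qed

end

theorem theorem4p1: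
  shows "\<exists>(P :: com) (p :: nat poly). \<forall>(k :: nat) (I :: pt_instance) (L :: listing).
    valid_instance k I \<longrightarrow> lists_instance L I \<longrightarrow>
    (\<exists>t arcs. computes P (enc_listing L) t (enc_arcs arcs) \<and>
       t \<le> poly p (val_size (enc_listing L)) \<and>
       distinct arcs \<and> polytree (nodes I) (set arcs) \<and>
       (\<forall>Dopt. max_score_polytree I Dopt \<longrightarrow>
          score I (set arcs) \<le> score I Dopt \<and>
          score I Dopt \<le> ereal (real (k + 1)) * score I (set arcs)))"
proof -
  obtain P p where P: "\<And>L. \<exists>t \<le> poly p (val_size (enc_listing L)).
      exec P (store (enc_listing L)) t (store (enc_arcs (greedy L)))"
    by (rule ptimeE[OF ptime_greedy]) (rule that)
  show ?thesis
  proof (rule exI[of _ P], rule exI[of _ p], intro allI impI)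
    fix k I L assume "valid_instance k I" "lists_instance L I"
    then interpret listed_instance k I L by unfold_locales
    obtain t where t: "t \<le> poly p (val_size (enc_listing L))"
      "exec P (store (enc_listing L)) t (store (enc_arcs (greedy L)))" using P by blast
    have comp: "computes P (enc_listing L) t (enc_arcs (greedy L))"
      unfolding computes_def
      by (rule exI[of _ "store (enc_arcs (greedy L))"]) (use t(2) in \<open>simp add: store_def\<close>)
    note G = greedy_correct(1,2)
    have "score I (set (greedy L)) \<le> score I D \<and>
        score I D \<le> ereal (real (k + 1)) * score I (set (greedy L))" if D: "max_score_polytree I D" for D
    proof
      show "score I (set (greedy L)) \<le> score I D"
        using D polytree_admissible[OF G(2)] by (simp add: max_score_polytree_def)
      show "score I D \<le> ereal (real (k + 1)) * score I (set (greedy L))"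
        using score_admissible[OF G(2)] score_admissible[OF max_score_polytree_admissible[OF D]]
          greedy_correct(3)[OF max_score_polytree_admissible[OF D]] by simp
    qed
    with comp t(1) G polytree_admissible[OF G(2)]
    show "\<exists>t arcs. computes P (enc_listing L) t (enc_arcs arcs) \<and>
       t \<le> poly p (val_size (enc_listing L)) \<and>
       distinct arcs \<and> polytree (nodes I) (set arcs) \<and>
       (\<forall>Dopt. max_score_polytree I Dopt \<longrightarrow>
          score I (set arcs) \<le> score I Dopt \<and>
          score I Dopt \<le> ereal (real (k + 1)) * score I (set arcs))"
      by blast
  qed
qed

end
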